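(* Let $f$, $\mathcal{I}$, and $\Lambda(\mathbf z,M)$ be as specified in the input to the Two-Dimensional DFT algorithm (described in the context). Additionally, let $\mathcal{A}_{s,M}$ be a noise-robust SFT algorithm which, for a function $a\in\mathcal{W}(\mathbb{T})\cap C(\mathbb{T})$ corrupted by some arbitrary noise $\mu:\mathbb{T}\to\mathbb{C}$, constructs an $s$-sparse Fourier approximation $\mathcal{A}_{s,M}(a+\mu)=:\mathbf v\in\mathbb{C}^M$ which 1. reconstructs every frequency (up to $s$ many) $\omega\in\mathcal{B}_M$ of $\mathbf F_M\mathbf a\in\mathbb{C}^M$ with corresponding Fourier coefficient meeting the tolerance $|(\mathbf F_M\mathbf a)_\omega|>\tau$; 2. satisfies the $\ell^\infty$ error estimate for recovered coefficients $$\|(\mathbf F_M\mathbf a-\mathbf v)|_{\operatorname{supp}(\mathbf v)}\|_\infty\le\eta_\infty<\tau;$$ 3. satisfies the $\ell^2$ error estimate $\|\mathbf F_M\mathbf a-\mathbf v\|_2\le\eta_2$; 4. and requires $\mathcal{O}(P(s,M))$ total evaluations of $a$, operating with computational complexity $\mathcal{O}(R(s,M))$, with the parameters $\tau$ and $\eta_\infty$ holding uniformly for each SFT performed in the Two-Dimensional DFT algorithm. Collect the $\tau$-significant frequencies of $f$ into the set $\mathcal{S}_\tau:=\{\mathbf k\in\mathcal{I}\mid|c_{\mathbf k}(f)|>\tau\}$ and assume that $|\operatorname{supp}(c)\cap\mathcal{S}_\tau|\le s$, where $c=c(f)$. Then the Two-Dimensional DFT algorithm (ignoring its optional check) will produce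 an $s$-sparse approximation $\mathbf b$ of the Fourier coefficients of $f$ satisfying the error estimate $$\|\mathbf b-c\|_{\ell^2(\mathbb{Z}^d)}\le\eta_2+(4\tau+\eta_\infty)\sqrt{\max(s-|\mathcal{S}_{4\tau}|,0)}+\|c|_{\mathcal{I}}-c|_{\mathcal{S}_{4\tau}}\|_{\ell^2(\mathbb{Z}^d)}+\|c-c|_{\mathcal{I}}\|_{\ell^2(\mathbb{Z}^d)},$$ requiring $\mathcal{O}(dN\cdot P(s,M))$ total evaluations of $f$, in $\mathcal{O}\big(dN(R(s,M)+sN\log N)\big)$ total operations.
   Context: Notation. $\mathbb{T}=[0,1]$ with endpoints identified; $[n]=\{0,\dots,n-1\}$; $\mathcal{B}_N:=(-\lceil N/2\rceil,\lfloor N/2\rfloor]\cap\mathbb{Z}$. For $f:\mathbb{T}^d\to\mathbb{C}$, $c_{\mathbf k}(f)=\int_{\mathbb{T}^d}f(\mathbf x)e^{-2\pi i\mathbf k\cdot\mathbf x}\,d\mathbf x$ and $c(f)=(c_{\mathbf k}(f))_{\mathbf k\in\mathbb{Z}^d}$; $\mathcal{W}(\mathbb{T}^d)=\{f\in L^1(\mathbb{T}^d):\sum_{\mathbf k}|c_{\mathbf k}(f)|<\infty\}$ and $C(\mathbb{T}^d)$ is the space of continuous functions. $c|_{\mathcal{J}}$ is the restriction to $\mathcal{J}\subset\mathbb{Z}^d$; finite vectors and restrictions are extended by zero when compared with sequences on larger index sets. $\mathcal{S}_{4\tau}$ is defined as $\mathcal{S}_\tau$ with $4\tau$ in place of $\tau$.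 "$s$-sparse" means at most $s$ nonzero entries. The $d$ coordinates are indexed by $\ell\in[d]$; $\mathbf e_\ell$ is the standard basis vector; one writes $\mathbf x=(x_\ell,\mathbf x_\ell')$, $\mathbf k=(k_\ell,\mathbf k_\ell')$, $\mathbf z=(z_\ell,\mathbf z_\ell')$, where the prime denotes the remaining $d-1$ coordinates. For univariate $a$, $\mathbf a=(a(j/M))_{j\in[M]}$ and $(\mathbf F_M\mathbf a)_\omega=\frac1M\sum_{j\in[M]}a(j/M)e^{-2\pi i\omega j/M}$; $\mathbf F_N$ is the analogous length-$N$ DFT. Indices of vectors and matrices are taken implicitly modulo the length of the dimension. An SFT (sparse Fourier transform) algorithm $\mathcal{A}_{s,M}$ takes a univariate function, accessed through point evaluations, and returns an $s$-sparse vector $\mathbf v\in\mathbb{C}^M$; it "reconstructs" $\omega$ if $\omega\in\operatorname{supp}(\mathbf v)$. Reconstructing lattice. For a generating vector $\mathbf z\in\mathbb{Z}^d$ (without loss of generality $\mathbf z\in[M]^d$), $\Lambda(\mathbf z,M)=\{\frac jM\mathbf z\bmod1\mid j\in[M]\}$; it is reconstructing for a finite set $\mathcal{J}\subset\mathbb{Z}^d$ if $\mathbf k\mapsto\mathbf k\cdot\mathbf z\bmod M$ is injective on $\mathcal{J}$. Two-Dimensional DFT algorithm. Input: a multivariate periodic function $f\in\mathcal{W}(\mathbb{T}^d)\cap C(\mathbb{T}^d)$ (from which potentially noisy samples can be obtained), a finite multivariate frequency set $\mathcal{I}\subset\mathcal{B}_N^d$, a rank-1 lattice $\Lambda(\mathbf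 z,M)$ which is reconstructing for $\mathcal{I}$ and for $\{\mathbf k-k_\ell\mathbf e_\ell\mid\mathbf k\in\mathcal{I}\}$ for all $\ell\in[d]$, and an SFT algorithm $\mathcal{A}_{s,M}$. (i) Apply $\mathcal{A}_{s,M}$ to $a(t)=f(t\mathbf z)$ to produce $\mathbf v=\mathcal{A}_{s,M}a$, a sparse approximation of $\mathbf F_M\mathbf a$. (ii) For every $\ell\in[d]$: for every $j\in[N]$ apply $\mathcal{A}_{s,M}$ to $a_j^\ell(t)=f(\frac jN,t\mathbf z_\ell')$ (coordinate $\ell$ equal to $j/N$, the remaining coordinates equal to $t\mathbf z_\ell'$) to produce $\mathbf v_j^\ell$, a sparse approximation of $\mathbf F_M\mathbf a_j^\ell$, and let $\mathbf v_j^\ell$ be row $j$ of a matrix $\mathbf V^\ell\in\mathbb{C}^{N\times M}$; then apply $\mathbf F_N$ to every nonzero column of $\mathbf V^\ell$ to produce $\mathbf F_N\mathbf V^\ell$. (iii) Set $\mathbf b\leftarrow\mathbf 0$. For every $\omega\in\operatorname{supp}(\mathbf v)$: for every $\ell\in[d]$ let $(k_\omega)_\ell$ be the first component of a minimizer $(h,\omega')$ of $|v_\omega-(\mathbf F_N\mathbf V^\ell)_{h,\omega'}|$ over all $(h,\omega')\in\mathcal{B}_N\times[M]$ with $hz_\ell+\omega'\equiv\omega\pmod M$; then, if $\mathbf k_\omega\cdot\mathbf z\equiv\omega\pmod M$ (and, as an optional check, $\mathbf k_\omega\in\mathcal{I}$), set $b_{\mathbf k_\omega}\leftarrow b_{\mathbf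 k_\omega}+v_\omega$. Output: the sparse coefficient vector $\mathbf b=(b_{\mathbf k})_{\mathbf k\in\mathcal{B}_N^d}$.
   Formalization: Conditions 1–3 are taken with a the restriction of f_I (the part of f with frequencies in I), the rest of f and sampling noise being μ; each row's F_M a is assumed to have at most s frequencies above τ; the operation bound is for N≥2, s≥1. *)

theory Defs
  imports "HOL-Analysis.Analysis" "HOL-Number_Theory.Cong" "HOL-Library.Monad_Syntax"
begin

section \<open>Fourier analysis on the torus\<close>

text \<open>
  The dimension \<open>d\<close> is a natural number that the constants in the complexity bounds must not
  depend on, so points, frequencies and generating vectors are functions on \<open>nat\<close> of which only
  the values on \<open>{..<d}\<close> matter. Points and frequencies are \<open>undefined\<close> outside \<open>{..<d}\<close>.
  Functions on the torus are functions on \<open>{..<d} \<rightarrow>\<^sub>E UNIV\<close> that are 1-periodic in each variable.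
\<close>

definition freqs :: "nat \<Rightarrow> (nat \<Rightarrow> int) set" where
  "freqs d = {..<d} \<rightarrow>\<^sub>E UNIV"

definition BN :: "nat \<Rightarrow> int set" where
  "BN N = {- \<lceil>real N / 2\<rceil> <.. \<lfloor>real N / 2\<rfloor>}"

definition freq_box :: "nat \<Rightarrow> nat \<Rightarrow> (nat \<Rightarrow> int) set" where
  "freq_box d N = {..<d} \<rightarrow>\<^sub>E BN N"

definition idot :: "nat \<Rightarrow> (nat \<Rightarrow> int) \<Rightarrow> (nat \<Rightarrow> int) \<Rightarrow> int" where
  "idot d k z = (\<Sum>i<d. k i * z i)"

definition character :: "nat \<Rightarrow> (nat \<Rightarrow> int) \<Rightarrow> (nat \<Rightarrow> real) \<Rightarrow> complex" where
  "character d k x = cis (2 * pi * (\<Sum>i<d. of_int (k i) * x i))"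

definition torus :: "nat \<Rightarrow> (nat \<Rightarrow> real) measure" where
  "torus d = PiM {..<d} (\<lambda>_. restrict_space lborel {0..1})"

definition fourier_coeff :: "nat \<Rightarrow> ((nat \<Rightarrow> real) \<Rightarrow> complex) \<Rightarrow> (nat \<Rightarrow> int) \<Rightarrow> complex" where
  "fourier_coeff d f k = (LINT x|torus d. f x * cnj (character d k x))"

definition periodic :: "nat \<Rightarrow> ((nat \<Rightarrow> real) \<Rightarrow> complex) \<Rightarrow> bool" where
  "periodic d f \<longleftrightarrow> (\<forall>x \<in> {..<d} \<rightarrow>\<^sub>E UNIV. \<forall>i<d. f (x(i := x i + 1)) = f x)"

definition continuous_torus :: "nat \<Rightarrow> ((nat \<Rightarrow> real) \<Rightarrow> complex) \<Rightarrow> bool" where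
  "continuous_torus d f \<longleftrightarrow> periodic d f \<and>
     continuous_map (product_topology (\<lambda>_. euclideanreal) {..<d}) euclidean f"

definition wiener :: "nat \<Rightarrow> ((nat \<Rightarrow> real) \<Rightarrow> complex) \<Rightarrow> bool" where
  "wiener d f \<longleftrightarrow> integrable (torus d) f \<and>
     (\<lambda>k. norm (fourier_coeff d f k)) summable_on freqs d"

definition restr :: "(nat \<Rightarrow> int) set \<Rightarrow> ((nat \<Rightarrow> int) \<Rightarrow> complex) \<Rightarrow> (nat \<Rightarrow> int) \<Rightarrow> complex" where
  "restr J c = (\<lambda>k. if k \<in> J then c k else 0)"

text \<open>
  Only meaningful for square-summable \<open>c\<close>; Fourier coefficients of a function with \<open>wiener d f\<close>
  are absolutely, hence square, summable.
\<close>

definition l2norm :: "nat \<Rightarrow> ((nat \<Rightarrow> int) \<Rightarrow> complex) \<Rightarrow> real" where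
  "l2norm d c = sqrt (\<Sum>\<^sub>\<infinity>k\<in>freqs d. (cmod (c k))\<^sup>2)"

definition fourier_trunc ::
    "nat \<Rightarrow> (nat \<Rightarrow> int) set \<Rightarrow> ((nat \<Rightarrow> real) \<Rightarrow> complex) \<Rightarrow> (nat \<Rightarrow> real) \<Rightarrow> complex" where
  "fourier_trunc d I f x = (\<Sum>k\<in>I. fourier_coeff d f k * character d k x)"

definition significant ::
    "nat \<Rightarrow> (nat \<Rightarrow> int) set \<Rightarrow> ((nat \<Rightarrow> real) \<Rightarrow> complex) \<Rightarrow> real \<Rightarrow> (nat \<Rightarrow> int) set" where
  "significant d I f \<tau> = {k \<in> I. cmod (fourier_coeff d f k) > \<tau>}"


section \<open>Rank-1 lattices\<close>

definition reconstructing :: "nat \<Rightarrow> (nat \<Rightarrow> int) \<Rightarrow> nat \<Rightarrow> (nat \<Rightarrow> int) set \<Rightarrow> bool" where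
  "reconstructing d z M J \<longleftrightarrow> inj_on (\<lambda>k. idot d k z mod int M) J"

definition lattice_pt :: "nat \<Rightarrow> (nat \<Rightarrow> int) \<Rightarrow> real \<Rightarrow> nat \<Rightarrow> real" where
  "lattice_pt d z t = (\<lambda>i\<in>{..<d}. t * of_int (z i))"

definition row_pt :: "nat \<Rightarrow> nat \<Rightarrow> (nat \<Rightarrow> int) \<Rightarrow> nat \<Rightarrow> nat \<Rightarrow> real \<Rightarrow> nat \<Rightarrow> real" where
  "row_pt d N z l j t = (\<lambda>i\<in>{..<d}. if i = l then real j / real N else t * of_int (z i))"


section \<open>Discrete Fourier transform and sparse Fourier transform guarantees\<close>

text \<open>
  Vectors of length \<open>n\<close> are functions on \<open>nat\<close>, indexed by \<open>{..<n}\<close>. The DFT is defined at every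
  integer and is \<open>n\<close>-periodic, which accounts for indices in \<open>BN n\<close>.
\<close>

definition dft :: "nat \<Rightarrow> (nat \<Rightarrow> complex) \<Rightarrow> int \<Rightarrow> complex" where
  "dft n x w = (\<Sum>j<n. x j * cis (- 2 * pi * of_int w * real j / real n)) / of_nat n"

definition dft_samples :: "nat \<Rightarrow> (real \<Rightarrow> complex) \<Rightarrow> int \<Rightarrow> complex" where
  "dft_samples M a = dft M (\<lambda>j. a (real j / real M))"

definition supp :: "nat \<Rightarrow> (nat \<Rightarrow> complex) \<Rightarrow> nat set" where
  "supp M v = {w. w < M \<and> v w \<noteq> 0}"

definition above_tol :: "nat \<Rightarrow> real \<Rightarrow> (real \<Rightarrow> complex) \<Rightarrow> int set" where
  "above_tol M \<tau> a = {w \<in> BN M. cmod (dft_samples M a w) > \<tau>}"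

text \<open>
  What a sparse Fourier transform run on noisy samples of the signal \<open>a\<close> guarantees for its output
  \<open>v\<close>. The first clause says that \<open>v\<close> is an \<open>s\<close>-sparse vector of length \<open>M\<close>, the second that it
  reconstructs every frequency above the tolerance, up to \<open>s\<close> many of them.

  The noise does not occur: it is the difference between the function the transform is run on,
  which determines \<open>v\<close>, and the signal \<open>a\<close>. The signals used are the restrictions to lattice
  lines of \<open>fourier_trunc d I f\<close>, so the noise consists of the part of \<open>f\<close> with frequencies
  outside \<open>I\<close> together with the sampling errors.
\<close>

definition sft_guarantee ::
    "nat \<Rightarrow> nat \<Rightarrow> real \<Rightarrow> real \<Rightarrow> real \<Rightarrow> (real \<Rightarrow> complex) \<Rightarrow> (nat \<Rightarrow> complex) \<Rightarrow> bool" where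
  "sft_guarantee s M \<tau> \<eta>inf \<eta>2 a v \<longleftrightarrow>
     (\<forall>w\<ge>M. v w = 0) \<and> card (supp M v) \<le> s \<and>
     min s (card (above_tol M \<tau> a))
       \<le> card {w \<in> above_tol M \<tau> a. nat (w mod int M) \<in> supp M v} \<and>
     0 \<le> \<eta>inf \<and> (\<forall>w \<in> supp M v. cmod (dft_samples M a (int w) - v w) \<le> \<eta>inf) \<and> \<eta>inf < \<tau> \<and>
     L2_set (\<lambda>w. cmod (dft_samples M a (int w) - v w)) {..<M} \<le> \<eta>2"


section \<open>Outputs of the two-dimensional DFT algorithm\<close>

text \<open>
  \<open>v\<close> is the vector from the first step, \<open>V l j\<close> is row \<open>j\<close> of the matrix for coordinate \<open>l\<close>.
  The minimizers are not unique in general; \<open>tddft_output\<close> admits every choice. The optional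
  check \<open>k \<in> I\<close> is not performed.
\<close>

definition tddft_output ::
    "nat \<Rightarrow> nat \<Rightarrow> nat \<Rightarrow> (nat \<Rightarrow> int) \<Rightarrow> (nat \<Rightarrow> complex) \<Rightarrow> (nat \<Rightarrow> nat \<Rightarrow> nat \<Rightarrow> complex)
      \<Rightarrow> ((nat \<Rightarrow> int) \<Rightarrow> complex) \<Rightarrow> bool" where
  "tddft_output d N M z v V b \<longleftrightarrow>
     (\<exists>\<kappa>. (\<forall>w \<in> supp M v. \<kappa> w \<in> freqs d \<and>
             (\<forall>l<d. \<exists>w'. is_arg_min
                (\<lambda>(h, w'). cmod (v w - dft N (\<lambda>j. V l j w') h))
                (\<lambda>(h, w'). h \<in> BN N \<and> w' < M \<and> [h * z l + int w' = int w] (mod int M))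
                (\<kappa> w l, w'))) \<and>
          b = (\<lambda>k. \<Sum>w | w \<in> supp M v \<and> \<kappa> w = k \<and> [idot d k z = int w] (mod int M). v w))"


section \<open>Programs with counted evaluations and operations\<close>

text \<open>
  An adaptive computation that evaluates an unknown function at points of type \<open>'q\<close>. Every
  \<open>Step\<close> stands for one elementary operation: arithmetic on numbers (including \<open>cis\<close> and \<open>cmod\<close>),
  a comparison, or an access to an array or dictionary. An evaluation also counts as one operation.
\<close>

datatype ('q, 'r) prog =
    Return 'r
  | Step "('q, 'r) prog"
  | Query 'q "complex \<Rightarrow> ('q, 'r) prog"

primrec run :: "('q \<Rightarrow> complex) \<Rightarrow> ('q, 'r) prog \<Rightarrow> 'r" where
  "run g (Return r) = r"
| "run g (Step p) = run g p"
| "run g (Query q c) = run g (c (g q))"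

primrec num_evals :: "('q \<Rightarrow> complex) \<Rightarrow> ('q, 'r) prog \<Rightarrow> nat" where
  "num_evals g (Return r) = 0"
| "num_evals g (Step p) = num_evals g p"
| "num_evals g (Query q c) = Suc (num_evals g (c (g q)))"

primrec num_ops :: "('q \<Rightarrow> complex) \<Rightarrow> ('q, 'r) prog \<Rightarrow> nat" where
  "num_ops g (Return r) = 0"
| "num_ops g (Step p) = Suc (num_ops g p)"
| "num_ops g (Query q c) = Suc (num_ops g (c (g q)))"

primrec bind_prog :: "('q, 'a) prog \<Rightarrow> ('a \<Rightarrow> ('q, 'b) prog) \<Rightarrow> ('q, 'b) prog" where
  "bind_prog (Return r) k = k r"
| "bind_prog (Step p) k = Step (bind_prog p k)"
| "bind_prog (Query q c) k = Query q (\<lambda>y. bind_prog (c y) k)"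

adhoc_overloading Monad_Syntax.bind \<rightleftharpoons> bind_prog

text \<open>\<open>p\<close> with its evaluation points transformed by \<open>\<phi>\<close>: if \<open>p\<close> is run on \<open>t \<mapsto> f (\<phi> t)\<close>,
  each of its evaluations is one evaluation of \<open>f\<close>. Computing the point \<open>\<phi> t\<close> is part of that
  evaluation and not charged separately.\<close>

definition along :: "('q \<Rightarrow> 'p) \<Rightarrow> ('q, 'r) prog \<Rightarrow> ('p, 'r) prog" where
  "along \<phi> p = map_prog \<phi> id p"

text \<open>
  \<open>work n\<close> charges for \<open>n\<close> loop iterations. No loop body charged in this way below consists of
  more than 16 elementary operations.
\<close>

definition work :: "nat \<Rightarrow> ('q, unit) prog" where
  "work n = (Step ^^ (16 * n)) (Return ())"

text \<open>Lists of complex numbers serve as arrays.\<close>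

definition tabulate :: "nat \<Rightarrow> (nat \<Rightarrow> complex) \<Rightarrow> ('q, complex list) prog" where
  "tabulate n F = do { work n; Return (map F [0..<n]) }"

primrec map_m :: "('a \<Rightarrow> ('q, 'b) prog) \<Rightarrow> 'a list \<Rightarrow> ('q, 'b list) prog" where
  "map_m f [] = Return []"
| "map_m f (x # xs) = do { work 1; y \<leftarrow> f x; ys \<leftarrow> map_m f xs; Return (y # ys) }"

primrec fold_m :: "('a \<Rightarrow> 'b \<Rightarrow> ('q, 'b) prog) \<Rightarrow> 'a list \<Rightarrow> 'b \<Rightarrow> ('q, 'b) prog" where
  "fold_m f [] b = Return b"
| "fold_m f (x # xs) b = do { work 1; b' \<leftarrow> f x b; fold_m f xs b' }"


section \<open>Fast Fourier transform\<close>

text \<open>Radix-2 transform of length \<open>2 ^ k\<close>, not normalized.\<close>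

primrec fft2 :: "nat \<Rightarrow> complex list \<Rightarrow> ('q, complex list) prog" where
  "fft2 0 xs = Return xs"
| "fft2 (Suc k) xs = do {
     ev \<leftarrow> tabulate (2 ^ k) (\<lambda>j. xs ! (2 * j));
     od \<leftarrow> tabulate (2 ^ k) (\<lambda>j. xs ! (2 * j + 1));
     ev' \<leftarrow> fft2 k ev;
     od' \<leftarrow> fft2 k od;
     tabulate (2 ^ Suc k) (\<lambda>w. ev' ! (w mod 2 ^ k)
       + cis (- 2 * pi * real w / real (2 ^ Suc k)) * od' ! (w mod 2 ^ k))
   }"

text \<open>
  Bluestein's algorithm for \<open>dft N\<close> with arbitrary \<open>N\<close>: since \<open>2wj = w\<^sup>2 + j\<^sup>2 - (w - j)\<^sup>2\<close>, the
  transform is a convolution, computed here as a cyclic one of length \<open>2 ^ k \<ge> 2 * N\<close>.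
  The last transform is inverse, expressed by conjugation.
\<close>

definition fft :: "nat \<Rightarrow> complex list \<Rightarrow> ('q, complex list) prog" where
  "fft N xs = (let k = (LEAST k. 2 * N \<le> 2 ^ k); L = 2 ^ k in do {
     work k;
     y \<leftarrow> tabulate L (\<lambda>j. if j < N then xs ! j * cis (- pi * (real j)\<^sup>2 / real N) else 0);
     p \<leftarrow> tabulate L (\<lambda>m. if m < N then cis (pi * (real m)\<^sup>2 / real N)
                       else if L - m < N then cis (pi * (real (L - m))\<^sup>2 / real N) else 0);
     y' \<leftarrow> fft2 k y;
     p' \<leftarrow> fft2 k p;
     u \<leftarrow> tabulate L (\<lambda>i. cnj (y' ! i * p' ! i));
     u' \<leftarrow> fft2 k u;
     tabulate N (\<lambda>w. cis (- pi * (real w)\<^sup>2 / real N) * cnj (u' ! w) / of_nat (L * N))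
   })"


section \<open>The two-dimensional DFT algorithm as a program\<close>

text \<open>A sparse vector is stored by its nonzero entries, so its support can be listed.\<close>

definition supp_list :: "nat \<Rightarrow> (nat \<Rightarrow> complex) \<Rightarrow> nat list" where
  "supp_list M v = sorted_list_of_set (supp M v)"

definition BN_list :: "nat \<Rightarrow> int list" where
  "BN_list N = [1 - \<lceil>real N / 2\<rceil> .. \<lfloor>real N / 2\<rfloor>]"

text \<open>
  Rows of the matrix for coordinate \<open>l\<close>, then the transforms of its nonzero columns. The result is
  a dictionary of columns; columns without an entry are zero.
\<close>

definition coord_prog ::
    "nat \<Rightarrow> nat \<Rightarrow> nat \<Rightarrow> (nat \<Rightarrow> int) \<Rightarrow> (real, nat \<Rightarrow> complex) prog \<Rightarrow> nat
      \<Rightarrow> (nat \<Rightarrow> real, nat \<Rightarrow> int \<Rightarrow> complex) prog" where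
  "coord_prog d N M z sft l = do {
     rows \<leftarrow> map_m (\<lambda>j. along (row_pt d N z l j) sft) [0..<N];
     let entries = concat (map (supp_list M) rows);
     work (N + length entries);
     let cols = remdups entries;
     ys \<leftarrow> map_m (\<lambda>w'. do { x \<leftarrow> tabulate N (\<lambda>j. (rows ! j) w'); fft N x }) cols;
     Return (\<lambda>w' h. case map_of (zip cols ys) w' of None \<Rightarrow> 0 | Some y \<Rightarrow> y ! nat (h mod int N))
   }"

text \<open>For each \<open>h\<close> in the search for a minimizer, \<open>w' = (w - h * z l) mod M\<close> is the only
  admissible second component.\<close>

definition tddft_prog ::
    "nat \<Rightarrow> nat \<Rightarrow> nat \<Rightarrow> (nat \<Rightarrow> int) \<Rightarrow> (real, nat \<Rightarrow> complex) prog
      \<Rightarrow> (nat \<Rightarrow> real, (nat \<Rightarrow> int) \<Rightarrow> complex) prog" where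
  "tddft_prog d N M z sft = do {
     v \<leftarrow> along (lattice_pt d z) sft;
     tabs \<leftarrow> map_m (coord_prog d N M z sft) [0..<d];
     fold_m (\<lambda>w b. do {
         ks \<leftarrow> map_m (\<lambda>l. do {
             work N;
             Return (arg_min_list
               (\<lambda>h. cmod (v w - (tabs ! l) (nat ((int w - h * z l) mod int M)) h)) (BN_list N))
           }) [0..<d];
         let k = (\<lambda>i\<in>{..<d}. ks ! i);
         work d;
         Return (if [idot d k z = int w] (mod int M) then b(k := b k + v w) else b)
       }) (supp_list M v) (\<lambda>_. 0)
   }"

end

theory Submission
  imports Defs "HOL-Library.Real_Mod"
begin

text \<open>
  Let \<open>c\<close> be the Fourier coefficients of \<open>f\<close> and let \<open>\<omega> k\<close> be the residue of \<open>k \<cdot> z\<close> modulo \<open>M\<close>.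
  Since the lattice is reconstructing, the DFT of the lattice samples of the truncated \<open>f\<close> is \<open>c k\<close> at
  \<open>\<omega> k\<close> for \<open>k \<in> I\<close> and 0 elsewhere, and the entries \<open>(h, w')\<close> of the two-dimensional DFT admissible
  in the search for coordinate \<open>l\<close> at \<open>\<omega> k\<close> all vanish except the one with \<open>h = k l\<close>, which is \<open>c k\<close>.
  All computed entries are exact up to \<open>\<tau>\<close>, so the search succeeds when \<open>cmod (c k) > 4 * \<tau>\<close>.

  The support of the output injects into that of \<open>v\<close> via \<open>\<omega>\<close>. The error on \<open>I\<close> splits into three
  sequences: coefficients at correctly assigned frequencies (bounded by \<open>\<eta>2\<close>); coefficients assigned to a
  frequency outside \<open>I\<close> although they belong to some \<open>k \<in> I\<close>, each at most \<open>4 * \<tau> + \<eta>inf\<close> and, as the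
  \<open>4 * \<tau>\<close>-significant frequencies already occupy places in the support, at most
  \<open>s - card (S (4 * \<tau>))\<close> many; and frequencies of \<open>I\<close> that are missing from the output.
\<close>

section \<open>Semantics and cost of the program combinators\<close>

lemma run_bind [simp]: "run g (bind_prog p k) = run g (k (run g p))"
  by (induction p) auto

lemma num_ops_bind [simp]: "num_ops g (bind_prog p k) = num_ops g p + num_ops g (k (run g p))"
  by (induction p) auto

lemma num_evals_bind [simp]:
  "num_evals g (bind_prog p k) = num_evals g p + num_evals g (k (run g p))"
  by (induction p) auto

lemma run_along [simp]: "run g (along \<phi> p) = run (\<lambda>t. g (\<phi> t)) p"
  by (induction p) (auto simp: along_def)

lemma num_ops_along [simp]: "num_ops g (along \<phi> p) = num_ops (\<lambda>t. g (\<phi> t)) p"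
  by (induction p) (auto simp: along_def)

lemma num_evals_along [simp]: "num_evals g (along \<phi> p) = num_evals (\<lambda>t. g (\<phi> t)) p"
  by (induction p) (auto simp: along_def)

lemma num_ops_steps: "num_ops g ((Step ^^ n) p) = n + num_ops g p"
  by (induction n) auto

lemma num_evals_steps: "num_evals g ((Step ^^ n) p) = num_evals g p"
  by (induction n) auto

lemma num_ops_work [simp]: "num_ops g (work n) = 16 * n"
  by (simp add: work_def num_ops_steps)

lemma num_evals_work [simp]: "num_evals g (work n) = 0"
  by (simp add: work_def num_evals_steps)

lemma run_tabulate [simp]: "run g (tabulate n F) = map F [0..<n]"
  by (simp add: tabulate_def)

lemma num_ops_tabulate [simp]: "num_ops g (tabulate n F) = 16 * n"
  by (simp add: tabulate_def)

lemma num_evals_tabulate [simp]: "num_evals g (tabulate n F) = 0"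
  by (simp add: tabulate_def)

lemma run_map_m [simp]: "run g (map_m f xs) = map (\<lambda>x. run g (f x)) xs"
  by (induction xs) auto

lemma num_ops_map_m [simp]:
  "num_ops g (map_m f xs) = (\<Sum>x\<leftarrow>xs. 16 + num_ops g (f x))"
  by (induction xs) auto

lemma num_evals_map_m [simp]:
  "num_evals g (map_m f xs) = (\<Sum>x\<leftarrow>xs. num_evals g (f x))"
  by (induction xs) auto

lemma run_fold_m [simp]: "run g (fold_m f xs b) = fold (\<lambda>x b. run g (f x b)) xs b"
  by (induction xs arbitrary: b) auto

lemma num_ops_fold_m_le:
  assumes "\<And>x b. num_ops g (f x b) \<le> B"
  shows "num_ops g (fold_m f xs b) \<le> length xs * (16 + B)"
proof (induction xs arbitrary: b)
  case (Cons x xs)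
  then show ?case
    using assms[of x b] by (simp add: add_mono add.assoc)
qed simp

lemma num_evals_fold_m_eq_0:
  assumes "\<And>x b. num_evals g (f x b) = 0"
  shows "num_evals g (fold_m f xs b) = 0"
  by (induction xs arbitrary: b) (auto simp: assms)


section \<open>The discrete Fourier transform\<close>

lemma cis_add_2pi_int: "cis (t + 2 * pi * of_int n) = cis t"
  by (simp flip: cis_mult)

text \<open>The summands are the powers of \<open>q\<close>, an \<open>n\<close>-th root of unity.
  The geometric sum is \<open>(q ^ n - 1) / (q - 1) = 0\<close> unless \<open>q = 1\<close>, which
  happens exactly when \<open>n\<close> divides \<open>m\<close>.\<close>

lemma sum_roots_of_unity:
  assumes "0 < n"
  shows "(\<Sum>j<n. cis (2 * pi * of_int m * real j / real n)) = (if int n dvd m then of_nat n else 0)"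
proof -
  define q where "q = cis (2 * pi * of_int m / real n)"
  have pow: "cis (2 * pi * of_int m * real j / real n) = q ^ j" for j
    unfolding q_def Complex.DeMoivre by (simp add: mult_ac)
  have q1: "q = 1 \<longleftrightarrow> int n dvd m"
  proof
    assume "q = 1"
    then obtain i :: int where "2 * pi * of_int m / real n = of_int i * (2 * pi)"
      unfolding q_def cis_eq_1_iff by blast
    then have "real_of_int m = of_int (int n * i)"
      using assms by (simp add: field_simps)
    then show "int n dvd m"
      by (metis dvd_triv_left of_int_eq_iff)
  next
    assume "int n dvd m"
    then obtain i where "m = int n * i" by blast
    then have "2 * pi * of_int m / real n = of_int i * (2 * pi)"
      using assms by simp
    then show "q = 1"
      unfolding q_def cis_eq_1_iff by blast
  qed
  have "q ^ n = 1"
    using pow[of n] assms by simp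
  then show ?thesis
    using q1 by (cases "q = 1") (simp_all add: pow geometric_sum)
qed

lemma dft_character:
  assumes "0 < n"
  shows "dft n (\<lambda>j. cis (2 * pi * of_int a * real j / real n)) w = of_bool [a = w] (mod int n)"
proof -
  have "cis (2 * pi * of_int a * real j / real n) * cis (- 2 * pi * of_int w * real j / real n)
      = cis (2 * pi * of_int (a - w) * real j / real n)" for j
    by (simp add: cis_mult diff_divide_distrib algebra_simps flip: add_divide_distrib)
  then show ?thesis
    using assms unfolding dft_def by (simp only: sum_roots_of_unity) (simp add: cong_iff_dvd_diff)
qed

lemma dft_sum: "dft n (\<lambda>j. \<Sum>k\<in>K. x k j) w = (\<Sum>k\<in>K. dft n (x k) w)"
  unfolding dft_def sum_distrib_right sum_divide_distrib by (rule sum.swap)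

lemma dft_cmult: "dft n (\<lambda>j. c * x j) w = c * dft n x w"
  by (simp add: dft_def sum_distrib_left mult.assoc)

lemma dft_diff: "dft n (\<lambda>j. x j - y j) w = dft n x w - dft n y w"
  by (simp add: dft_def left_diff_distrib sum_subtractf diff_divide_distrib)

lemma dft_mod_cong:
  assumes "0 < n" "[w = w'] (mod int n)"
  shows "dft n x w = dft n x w'"
proof -
  obtain q where q: "w = w' + int n * q"
    using cong_sym[OF assms(2)] unfolding cong_iff_lin by blast
  have "cis (- 2 * pi * of_int w * real j / real n) = cis (- 2 * pi * of_int w' * real j / real n)" for j
  proof -
    have "- 2 * pi * of_int w * real j / real n
        = - 2 * pi * of_int w' * real j / real n + 2 * pi * of_int (- q * int j)"
      using assms(1) by (simp add: q field_simps)
    then show ?thesis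
      by (simp only: cis_add_2pi_int)
  qed
  then show ?thesis by (simp add: dft_def)
qed

text \<open>Thanks to the normalization by \<open>1 / n\<close> the transform is a contraction in
  the maximum norm. This carries an entrywise error bound on the rows over to the transformed
  columns.\<close>

lemma cmod_dft_le:
  assumes "\<And>j. j < n \<Longrightarrow> cmod (x j) \<le> e" "0 < n"
  shows "cmod (dft n x w) \<le> e"
proof -
  have "cmod (\<Sum>j<n. x j * cis (- 2 * pi * of_int w * real j / real n)) \<le> (\<Sum>j<n. e)"
    using assms(1) by (intro sum_norm_le) (simp add: norm_mult)
  then show ?thesis
    using assms(2) by (simp add: dft_def norm_divide field_simps)
qed


section \<open>The fast Fourier transform\<close>

lemma sum_even_odd: "(\<Sum>j<2 * n. h j) = (\<Sum>j<n. h (2 * j)) + (\<Sum>j<n. h (2 * j + 1 :: nat) :: 'a :: comm_monoid_add)"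
  by (induction n) (simp_all add: ac_simps)

text \<open>In a radix-2 step the half-length transforms are read at \<open>w mod n\<close>; by
  periodicity this is their value at \<open>w\<close>.\<close>

lemma cis_mod_eq:
  assumes "0 < n"
  shows "cis (- 2 * pi * real (w mod n) * real j / real n) = cis (- 2 * pi * real w * real j / real n)"
proof -
  have "real w = real (w mod n) + real n * real (w div n)"
    by (metis mod_mult_div_eq of_nat_add of_nat_mult)
  then have "- 2 * pi * real (w mod n) * real j / real n
      = - 2 * pi * real w * real j / real n + 2 * pi * of_int (int (w div n) * int j)"
    using assms by (simp add: field_simps)
  then show ?thesis
    by (simp only: cis_add_2pi_int)
qed

text \<open>Decimation in time: the sum is split into even and odd positions. Each part is a
  transform of half the length, the odd one multiplied by the twiddle factor.\<close>

lemma run_fft2: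
  assumes "w < 2 ^ k"
  shows "run g (fft2 k xs) ! w = (\<Sum>j<2 ^ k. xs ! j * cis (- 2 * pi * real w * real j / real (2 ^ k)))"
  using assms
proof (induction k arbitrary: xs w)
  case (Suc k)
  define K :: nat where "K = 2 ^ k"
  have K: "0 < K" by (simp add: K_def)
  have w: "w mod K < 2 ^ k" "w < 2 * K"
    using Suc.prems by (auto simp: K_def)
  have even: "cis (- 2 * pi * real w * real j / real K)
      = cis (- 2 * pi * real w * real (2 * j) / real (2 * K))" for j
    using K by (simp add: mult_ac)
  have odd: "cis (- 2 * pi * real w / real (2 * K)) * cis (- 2 * pi * real w * real j / real K)
      = cis (- 2 * pi * real w * real (2 * j + 1) / real (2 * K))" for j
  proof -
    have "- 2 * pi * real w / real (2 * K) + - 2 * pi * real w * real j / real K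
        = - 2 * pi * real w * real (2 * j + 1) / real (2 * K)"
      using K by (simp add: field_simps)
    then show ?thesis by (simp only: cis_mult)
  qed
  have "run g (fft2 (Suc k) xs) ! w
      = (\<Sum>j<K. xs ! (2 * j) * cis (- 2 * pi * real (w mod K) * real j / real K))
      + cis (- 2 * pi * real w / real (2 * K))
        * (\<Sum>j<K. xs ! (2 * j + 1) * cis (- 2 * pi * real (w mod K) * real j / real K))"
    using w Suc.IH[OF w(1)] by (simp flip: K_def)
  also have "\<dots> = (\<Sum>j<K. xs ! (2 * j) * cis (- 2 * pi * real w * real (2 * j) / real (2 * K)))
      + (\<Sum>j<K. xs ! (2 * j + 1) * cis (- 2 * pi * real w * real (2 * j + 1) / real (2 * K)))"
    unfolding cis_mod_eq[OF K] sum_distrib_left even[symmetric] odd[symmetric]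
    by (simp add: mult_ac)
  also have "\<dots> = (\<Sum>j<2 * K. xs ! j * cis (- 2 * pi * real w * real j / real (2 * K)))"
    by (rule sum_even_odd[symmetric])
  finally show ?case by (simp add: K_def)
qed simp

text \<open>The three tabulations of one level cost \<open>64 * 2 ^ k\<close>, so the claim solves
  the recurrence \<open>T (k + 1) = 2 * T k + 64 * 2 ^ k\<close> with
  \<open>T 0 = 0\<close>.\<close>

lemma num_ops_fft2: "num_ops g (fft2 k xs) = 32 * k * 2 ^ k"
  by (induction k arbitrary: xs) (simp_all add: algebra_simps)

lemma num_evals_fft2 [simp]: "num_evals g (fft2 k xs) = 0"
  by (induction k arbitrary: xs) simp_all

text \<open>The inverse transform of a product, expressed by conjugation as in \<open>fft\<close>.\<close>

lemma cyclic_convolution: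
  fixes x y :: "nat \<Rightarrow> complex" and L :: nat
  defines "T \<equiv> \<lambda>x w. \<Sum>j<L. x j * cis (- 2 * pi * real w * real j / real L)"
  assumes "w < L"
  shows "cnj (T (\<lambda>i. cnj (T x i * T y i)) w)
    = of_nat L * (\<Sum>j<L. x j * y (nat ((int w - int j) mod int L)))"
proof -
  have L: "0 < L" using assms by simp
  have m: "(\<Sum>m<L. if [int j + int m = int w] (mod int L) then y m else 0)
      = y (nat ((int w - int j) mod int L))" for j
  proof -
    have "[int j + int m = int w] (mod int L) \<longleftrightarrow> m = nat ((int w - int j) mod int L)" if "m < L" for m
    proof -
      have "[int j + int m = int w] (mod int L) \<longleftrightarrow> [int m = int w - int j] (mod int L)"
        by (simp add: cong_iff_dvd_diff algebra_simps)
      also have "\<dots> \<longleftrightarrow> int m = (int w - int j) mod int L"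
        using that by (simp add: cong_def)
      finally show ?thesis using L by (auto simp: nat_eq_iff2)
    qed
    then have "(\<Sum>m<L. if [int j + int m = int w] (mod int L) then y m else 0)
        = (\<Sum>m<L. if m = nat ((int w - int j) mod int L) then y m else 0)"
      by (intro sum.cong) auto
    also have "\<dots> = y (nat ((int w - int j) mod int L))"
      using L by (simp add: nat_less_iff)
    finally show ?thesis .
  qed
  have c: "cis (- 2 * pi * real i * real j / real L) * cis (- 2 * pi * real i * real m / real L)
      * cis (2 * pi * real w * real i / real L)
    = cis (2 * pi * of_int (int w - int j - int m) * real i / real L)" for i j m
    by (simp add: cis_mult algebra_simps flip: add_divide_distrib diff_divide_distrib)
  have "cnj (T (\<lambda>i. cnj (T x i * T y i)) w)
      = (\<Sum>i<L. T x i * T y i * cis (2 * pi * real w * real i / real L))"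
    unfolding T_def by (simp add: cis_cnj)
  also have "\<dots> = (\<Sum>i<L. \<Sum>j<L. \<Sum>m<L. x j * y m * (cis (- 2 * pi * real i * real j / real L)
      * cis (- 2 * pi * real i * real m / real L) * cis (2 * pi * real w * real i / real L)))"
    unfolding T_def sum_product unfolding sum_distrib_right
    by (intro sum.cong refl) (simp only: mult_ac)
  \<comment> \<open>The sum over \<open>i\<close> is moved inside, where it becomes a sum of roots
    of unity that selects the pairs with \<open>j + m\<close> congruent to \<open>w\<close>.\<close>
  also have "\<dots> = (\<Sum>j<L. \<Sum>m<L. \<Sum>i<L. x j * y m * (cis (- 2 * pi * real i * real j / real L)
      * cis (- 2 * pi * real i * real m / real L) * cis (2 * pi * real w * real i / real L)))"
    by (rule trans[OF sum.swap]) (intro sum.cong refl sum.swap)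
  also have "\<dots> = (\<Sum>j<L. \<Sum>m<L. x j * y m
      * (\<Sum>i<L. cis (2 * pi * of_int (int w - int j - int m) * real i / real L)))"
    unfolding c sum_distrib_left by (rule refl)
  also have "\<dots> = (\<Sum>j<L. \<Sum>m<L. of_nat L
      * (x j * (if [int j + int m = int w] (mod int L) then y m else 0)))"
  proof (intro sum.cong refl)
    fix j m
    have "int L dvd int w - int j - int m \<longleftrightarrow> [int j + int m = int w] (mod int L)"
      by (subst cong_sym_eq) (simp add: cong_iff_dvd_diff algebra_simps)
    then show "x j * y m * (\<Sum>i<L. cis (2 * pi * of_int (int w - int j - int m) * real i / real L))
      = of_nat L * (x j * (if [int j + int m = int w] (mod int L) then y m else 0))"
      unfolding sum_roots_of_unity[OF L] by simp
  qed
  also have "\<dots> = of_nat L * (\<Sum>j<L. x j * y (nat ((int w - int j) mod int L)))"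
    by (simp add: m flip: sum_distrib_left)
  finally show ?thesis .
qed

text \<open>The chirp identity turns the transform into a convolution with \<open>y\<close>. Because
  \<open>2 * N \<le> L\<close>, the cyclic convolution has no wrap-around collisions: differences
  \<open>w - j\<close> of either sign occupy separate ends of \<open>y\<close>.\<close>

lemma run_fft:
  assumes "w < N"
  shows "run g (fft N xs) ! w = dft N (\<lambda>j. xs ! j) (int w)"
proof -
  define k where "k = (LEAST k. 2 * N \<le> 2 ^ k)"
  define L :: nat where "L = 2 ^ k"
  \<comment> \<open>The exponent \<open>2 * N\<close> shows that the \<open>LEAST\<close> in the
    definition of \<open>k\<close> is attained.\<close>
  have "2 * N \<le> 2 ^ (2 * N)"
    by (rule less_imp_le[OF less_exp])
  then have L: "2 * N \<le> L"
    unfolding L_def k_def by (rule LeastI)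
  define x where "x j = (if j < N then xs ! j * cis (- pi * (real j)\<^sup>2 / real N) else 0)" for j
  define y where "y m = (if m < N then cis (pi * (real m)\<^sup>2 / real N)
      else if L - m < N then cis (pi * (real (L - m))\<^sup>2 / real N) else 0)" for m
  define T where "T x w = (\<Sum>j<L. x j * cis (- 2 * pi * real w * real j / real L))" for x w
  have T: "run g (fft2 k (map x [0..<L])) ! i = T x i" if "i < L" for x i and g :: "'a \<Rightarrow> complex"
  proof -
    have "run g (fft2 k (map x [0..<L])) ! i
        = (\<Sum>j<L. map x [0..<L] ! j * cis (- 2 * pi * real i * real j / real L))"
      using that run_fft2[of i k g] by (simp add: L_def)
    also have "\<dots> = T x i"
      unfolding T_def by (intro sum.cong) auto
    finally show ?thesis .
  qed
  define u where "u i = cnj (run g (fft2 k (map x [0..<L])) ! i * run g (fft2 k (map y [0..<L])) ! i)" for i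
  have "run g (fft N xs)
      = map (\<lambda>w. cis (- pi * (real w)\<^sup>2 / real N)
          * cnj (run g (fft2 k (map u [0..<L])) ! w) / of_nat (L * N)) [0..<N]"
    unfolding fft_def Let_def k_def[symmetric] L_def[symmetric]
    by (simp add: x_def[abs_def] y_def[abs_def] u_def[abs_def])
  then have "run g (fft N xs) ! w = cis (- pi * (real w)\<^sup>2 / real N)
          * cnj (run g (fft2 k (map u [0..<L])) ! w) / of_nat (L * N)"
    using assms by simp
  also have "run g (fft2 k (map u [0..<L])) ! w = T (\<lambda>i. cnj (T x i * T y i)) w"
  proof -
    have "T u w = T (\<lambda>i. cnj (T x i * T y i)) w"
      unfolding T_def[of u] T_def[of "\<lambda>i. cnj (T x i * T y i)"]
      by (intro sum.cong) (auto simp: u_def T)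
    then show ?thesis using T[of w g u] assms L by simp
  qed
  also have "cnj (T (\<lambda>i. cnj (T x i * T y i)) w)
      = of_nat L * (\<Sum>j<L. x j * y (nat ((int w - int j) mod int L)))"
    unfolding T_def using cyclic_convolution[of w L x y] assms L by simp
  also have "(\<Sum>j<L. x j * y (nat ((int w - int j) mod int L)))
      = (\<Sum>j<N. xs ! j * cis (- pi * (real j)\<^sup>2 / real N) * cis (pi * (real w - real j)\<^sup>2 / real N))"
  proof -
    have "y (nat ((int w - int j) mod int L)) = cis (pi * (real w - real j)\<^sup>2 / real N)" if "j < N" for j
    proof (cases "j \<le> w")
      case True
      have "(int w - int j) mod int L = int (w - j)"
        using True assms L by (simp add: of_nat_diff)
      then have "nat ((int w - int j) mod int L) = w - j"
        by simp
      moreover have "w - j < N"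
        using assms by simp
      ultimately show ?thesis
        using True by (simp add: y_def of_nat_diff)
    next
      case False
      \<comment> \<open>A negative difference wraps around to \<open>L - (j - w)\<close>, which is
        at least \<open>N\<close>. The second branch of \<open>y\<close> applies there, and it
        stores the same chirp because the square ignores the sign.\<close>
      have "(int w - int j) mod int L = (int w - int j + int L) mod int L"
        by simp
      also have "\<dots> = int (L - (j - w))"
        using False assms that L by (subst mod_pos_pos_trivial) (auto simp: of_nat_diff)
      finally have "nat ((int w - int j) mod int L) = L - (j - w)"
        by simp
      moreover have "\<not> L - (j - w) < N" "L - (L - (j - w)) = j - w" "j - w < N"
        using False assms that L by auto
      moreover have "(real (j - w))\<^sup>2 = (real w - real j)\<^sup>2"
        using False by (simp add: of_nat_diff power2_commute)
      ultimately show ?thesis by (simp add: y_def)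
    qed
    then have "(\<Sum>j<N. xs ! j * cis (- pi * (real j)\<^sup>2 / real N) * cis (pi * (real w - real j)\<^sup>2 / real N))
        = (\<Sum>j<N. x j * y (nat ((int w - int j) mod int L)))"
      by (intro sum.cong) (auto simp: x_def)
    also have "\<dots> = (\<Sum>j<L. x j * y (nat ((int w - int j) mod int L)))"
      using L by (intro sum.mono_neutral_left) (auto simp: x_def)
    finally show ?thesis ..
  qed
  also have "cis (- pi * (real w)\<^sup>2 / real N) * (of_nat L * \<dots>) / of_nat (L * N)
      = (\<Sum>j<N. xs ! j * (cis (- pi * (real w)\<^sup>2 / real N) * cis (- pi * (real j)\<^sup>2 / real N)
          * cis (pi * (real w - real j)\<^sup>2 / real N))) / of_nat N"
  proof -
    have "a * (of_nat L * b) / of_nat (L * N) = a * b / of_nat N" for a b :: complex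
      using assms L by simp
    then have "cis (- pi * (real w)\<^sup>2 / real N) * (of_nat L * S) / of_nat (L * N)
        = cis (- pi * (real w)\<^sup>2 / real N) * S / of_nat N" for S .
    then show ?thesis
      by (simp only:) (simp only: sum_distrib_left mult_ac)
  qed
  also have "\<dots> = dft N (\<lambda>j. xs ! j) (int w)"
  proof -
    have "- pi * (real w)\<^sup>2 / real N + - pi * (real j)\<^sup>2 / real N + pi * (real w - real j)\<^sup>2 / real N
        = - 2 * pi * of_int (int w) * real j / real N" for j
      by (simp add: power2_eq_square algebra_simps flip: add_divide_distrib diff_divide_distrib)
    then show ?thesis
      unfolding dft_def cis_mult by simp
  qed
  finally show ?thesis .
qed


section \<open>Square-summable sequences\<close>

text \<open>Minkowski's inequality on finite subsets bounds all partial sums uniformly, which yields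
  both the summability of the sum sequence and the bound on its norm.\<close>

lemma l2norm_triangle:
  assumes "(\<lambda>k. (cmod (x k))\<^sup>2) summable_on freqs d" "(\<lambda>k. (cmod (y k))\<^sup>2) summable_on freqs d"
  shows "l2norm d (\<lambda>k. x k + y k) \<le> l2norm d x + l2norm d y"
proof -
  have sum_le: "(\<Sum>k\<in>F. (cmod (x k + y k))\<^sup>2) \<le> (l2norm d x + l2norm d y)\<^sup>2"
    if F: "finite F" "F \<subseteq> freqs d" for F
  proof -
    have le: "L2_set (\<lambda>k. cmod (u k)) F \<le> l2norm d u"
      if "(\<lambda>k. (cmod (u k))\<^sup>2) summable_on freqs d" for u
      unfolding L2_set_def l2norm_def using that F
      by (intro real_sqrt_le_mono finite_sum_le_infsum) auto
    have "L2_set (\<lambda>k. cmod (x k + y k)) F \<le> L2_set (\<lambda>k. cmod (x k) + cmod (y k)) F"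
      by (intro L2_set_mono norm_triangle_ineq) auto
    also have "\<dots> \<le> L2_set (\<lambda>k. cmod (x k)) F + L2_set (\<lambda>k. cmod (y k)) F"
      by (rule L2_set_triangle_ineq)
    also have "\<dots> \<le> l2norm d x + l2norm d y"
      using assms by (intro add_mono le)
    finally have "(L2_set (\<lambda>k. cmod (x k + y k)) F)\<^sup>2 \<le> (l2norm d x + l2norm d y)\<^sup>2"
      by (intro power_mono) auto
    then show ?thesis by (simp add: L2_set_def sum_nonneg)
  qed
  have "(\<lambda>k. (cmod (x k + y k))\<^sup>2) summable_on freqs d"
    using sum_le by (intro nonneg_bdd_above_summable_on bdd_aboveI2) auto
  then have "(\<Sum>\<^sub>\<infinity>k\<in>freqs d. (cmod (x k + y k))\<^sup>2) \<le> (l2norm d x + l2norm d y)\<^sup>2"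
    using sum_le by (intro infsum_le_finite_sums) auto
  then have "l2norm d (\<lambda>k. x k + y k) \<le> sqrt ((l2norm d x + l2norm d y)\<^sup>2)"
    unfolding l2norm_def by (rule real_sqrt_le_mono)
  moreover have "0 \<le> l2norm d x + l2norm d y"
    by (simp add: l2norm_def infsum_nonneg)
  ultimately show ?thesis by simp
qed

lemma square_summable_finite:
  assumes "finite F" "\<And>k. k \<notin> F \<Longrightarrow> x k = 0"
  shows "(\<lambda>k. (cmod (x k))\<^sup>2) summable_on freqs d"
proof -
  have "(\<lambda>k. (cmod (x k))\<^sup>2) summable_on (F \<inter> freqs d)"
    using assms(1) by (intro summable_on_finite) auto
  then show ?thesis
    by (subst summable_on_cong_neutral[of "F \<inter> freqs d" _ _ "\<lambda>k. (cmod (x k))\<^sup>2"]) (auto simp: assms(2))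
qed

lemma l2norm_finite:
  assumes "finite F" "F \<subseteq> freqs d" "\<And>k. k \<notin> F \<Longrightarrow> x k = 0"
  shows "l2norm d x = L2_set (\<lambda>k. cmod (x k)) F"
proof -
  have "(\<Sum>\<^sub>\<infinity>k\<in>freqs d. (cmod (x k))\<^sup>2) = (\<Sum>\<^sub>\<infinity>k\<in>F. (cmod (x k))\<^sup>2)"
    using assms by (intro infsum_cong_neutral) auto
  then show ?thesis
    using assms(1) by (simp add: l2norm_def L2_set_def)
qed

text \<open>Every term is at most the total \<open>B\<close>, so its square is at most
  \<open>B\<close> times the term.\<close>

lemma square_summable_if_abs_summable:
  fixes x :: "'a \<Rightarrow> complex"
  assumes "(\<lambda>k. cmod (x k)) summable_on A"
  shows "(\<lambda>k. (cmod (x k))\<^sup>2) summable_on A"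
proof (rule summable_on_comparison_test)
  define B where "B = infsum (\<lambda>k. cmod (x k)) A"
  show "(\<lambda>k. B * cmod (x k)) summable_on A"
    using assms by (rule summable_on_cmult_right)
  fix k assume "k \<in> A"
  then have "cmod (x k) \<le> B"
    using finite_sum_le_infsum[OF assms, of "{k}"] by (simp add: B_def)
  then show "(cmod (x k))\<^sup>2 \<le> B * cmod (x k)"
    by (simp add: power2_eq_square mult_right_mono)
qed auto


section \<open>Sampling along lattice lines\<close>

lemma BN_iff: "h \<in> BN N \<longleftrightarrow> - int N < 2 * h \<and> 2 * h \<le> int N"
proof -
  have "- \<lceil>real N / 2\<rceil> < h \<longleftrightarrow> - h < \<lceil>real N / 2\<rceil>" by linarith
  also have "\<dots> \<longleftrightarrow> real_of_int (- h) < real N / 2" by (rule less_ceiling_iff)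
  also have "\<dots> \<longleftrightarrow> - int N < 2 * h" by linarith
  finally show ?thesis
    by (auto simp: BN_def le_floor_iff)
qed

lemma finite_BN [simp]: "finite (BN N)"
  by (simp add: BN_def)

lemma BN_cong_imp_eq:
  assumes "h \<in> BN N" "h' \<in> BN N" "[h = h'] (mod int N)"
  shows "h = h'"
proof (rule ccontr)
  assume "h \<noteq> h'"
  then have "int N \<le> \<bar>h - h'\<bar>"
    using assms(3) by (intro zdvd_imp_le) (auto simp: cong_iff_dvd_diff)
  then show False
    using assms(1,2) by (auto simp: BN_iff)
qed

lemma BN_representative:
  assumes "0 < N"
  obtains h where "h \<in> BN N" "[h = w] (mod int N)"
proof -
  define r where "r = w mod int N"
  have r: "0 \<le> r" "r < int N" "[r = w] (mod int N)" "[r - int N = w] (mod int N)"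
    using assms by (auto simp: r_def cong_def)
  \<comment> \<open>The least nonnegative residue is kept if it is at most \<open>N / 2\<close> and
    shifted down by \<open>N\<close> otherwise; the endpoint \<open>N / 2\<close> itself belongs to
    \<open>BN N\<close>.\<close>
  show thesis
    using that[of r] that[of "r - int N"] r by (cases "2 * r \<le> int N") (auto simp: BN_iff)
qed

lemma finite_freq_box [simp]: "finite (freq_box d N)"
  by (simp add: freq_box_def finite_PiE)

lemma freq_box_subset_freqs: "freq_box d N \<subseteq> freqs d"
  by (auto simp: freq_box_def freqs_def PiE_def)

lemma idot_split:
  assumes "l < d"
  shows "idot d k z = k l * z l + idot d (k(l := 0)) z"
  using assms by (simp add: idot_def sum.remove[of "{..<d}" l] sum.If_cases cong: sum.cong)
    (auto intro!: sum.cong)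

section \<open>Aliasing formulas for samples on lattice lines\<close>

lemma dft_samples_mod_cong:
  "0 < M \<Longrightarrow> [w = w'] (mod int M) \<Longrightarrow> dft_samples M a w = dft_samples M a w'"
  unfolding dft_samples_def by (rule dft_mod_cong)

text \<open>On the lattice line the character of \<open>k\<close> becomes a univariate exponential
  of frequency \<open>idot d k z\<close>, so its DFT collects coefficients by residue modulo
  \<open>M\<close>.\<close>

lemma dft_samples_lattice:
  assumes "0 < M"
  shows "dft_samples M (\<lambda>t. fourier_trunc d I f (lattice_pt d z t)) w
    = (\<Sum>k\<in>I. fourier_coeff d f k * of_bool [idot d k z = w] (mod int M))"
proof -
  have "character d k (lattice_pt d z (real j / real M))
      = cis (2 * pi * of_int (idot d k z) * real j / real M)" for k j
    unfolding character_def lattice_pt_def idot_def of_int_sum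
    by (simp add: sum_distrib_right sum_distrib_left sum_divide_distrib mult_ac)
  then show ?thesis
    unfolding dft_samples_def fourier_trunc_def dft_sum dft_cmult
    by (simp only: dft_character[OF assms])
qed

text \<open>Freezing coordinate \<open>l\<close> at \<open>j / N\<close> splits each character into
  a phase depending on \<open>k l\<close> and \<open>j\<close>, and an exponential whose frequency
  comes from the remaining coordinates. The phase is what the transform over \<open>j\<close>
  detects afterwards.\<close>

lemma dft_samples_row:
  assumes "0 < M" "l < d"
  shows "dft_samples M (\<lambda>t. fourier_trunc d I f (row_pt d N z l j t)) w
    = (\<Sum>k\<in>I. fourier_coeff d f k * of_bool [idot d (k(l := 0)) z = w] (mod int M)
        * cis (2 * pi * of_int (k l) * real j / real N))"
proof -
  have "character d k (row_pt d N z l j (real i / real M))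
      = cis (2 * pi * of_int (k l) * real j / real N)
        * cis (2 * pi * of_int (idot d (k(l := 0)) z) * real i / real M)" for k i
  proof -
    have "(\<Sum>m<d. of_int (k m) * row_pt d N z l j (real i / real M) m)
        = of_int (k l) * (real j / real N)
          + (\<Sum>m\<in>{..<d} - {l}. of_int (k m) * (real i / real M * of_int (z m)))"
      using assms(2) by (simp add: sum.remove[of "{..<d}" l] row_pt_def)
    also have "(\<Sum>m\<in>{..<d} - {l}. of_int (k m) * (real i / real M * of_int (z m)))
        = of_int (idot d (k(l := 0)) z) * real i / real M"
      using assms(2) unfolding idot_def of_int_sum
      by (simp add: sum.remove[of "{..<d}" l] sum_distrib_left sum_divide_distrib mult_ac)
    finally show ?thesis
      unfolding character_def cis_mult by (simp add: algebra_simps)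
  qed
  then show ?thesis
    unfolding dft_samples_def fourier_trunc_def dft_sum dft_cmult
    by (simp only: dft_cmult dft_character[OF assms(1)]) (simp only: mult_ac)
qed

lemma dft_dft_samples_row:
  assumes "0 < M" "0 < N" "l < d"
  shows "dft N (\<lambda>j. dft_samples M (\<lambda>t. fourier_trunc d I f (row_pt d N z l j t)) w) h
    = (\<Sum>k\<in>I. fourier_coeff d f k * of_bool [idot d (k(l := 0)) z = w] (mod int M)
        * of_bool [k l = h] (mod int N))"
  unfolding dft_samples_row[OF assms(1,3)] dft_sum dft_cmult dft_character[OF assms(2)] ..


section \<open>Consequences of the guarantees of a sparse Fourier transform\<close>

text \<open>If at most \<open>s\<close> frequencies exceed the tolerance, the recovered ones form a
  subset of full cardinality, hence all of them. As the tolerance set lives in \<open>BN M\<close>,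
  the index \<open>w\<close> is first replaced by its balanced representative.\<close>

lemma sft_guarantee_recovers:
  assumes "sft_guarantee s M \<tau> \<eta>inf \<eta>2 a v" "card (above_tol M \<tau> a) \<le> s"
    and "w < M" "\<tau> < cmod (dft_samples M a (int w))"
  shows "w \<in> supp M v"
proof -
  let ?A = "above_tol M \<tau> a"
  have "finite ?A"
    by (rule finite_subset[OF _ finite_BN[of M]]) (auto simp: above_tol_def)
  moreover have "card ?A \<le> card {w \<in> ?A. nat (w mod int M) \<in> supp M v}"
    using assms(1,2) by (simp add: sft_guarantee_def min_absorb2)
  ultimately have all: "{w \<in> ?A. nat (w mod int M) \<in> supp M v} = ?A"
    by (intro card_seteq) auto
  obtain h where h: "h \<in> BN M" "[h = int w] (mod int M)"
    using BN_representative[of M "int w"] assms(3) by auto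
  then have "h \<in> ?A"
    using assms(3,4) dft_samples_mod_cong[of M h "int w" a] by (simp add: above_tol_def)
  moreover have "nat (h mod int M) = w"
    using h(2) assms(3) by (simp add: cong_def)
  ultimately show ?thesis
    using all by auto
qed

text \<open>Entries in the support are off by at most \<open>\<eta>inf\<close>, which is below
  \<open>\<tau>\<close>. Off the support the output is 0, and the exact value is at most
  \<open>\<tau>\<close>, since it would have been recovered otherwise.\<close>

lemma sft_guarantee_uniform:
  assumes "sft_guarantee s M \<tau> \<eta>inf \<eta>2 a v" "card (above_tol M \<tau> a) \<le> s" "w < M"
  shows "cmod (dft_samples M a (int w) - v w) \<le> \<tau>"
proof (cases "w \<in> supp M v")
  case True
  then show ?thesis
    using assms(1) unfolding sft_guarantee_def by fastforce
next
  case False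
  then have "v w = 0"
    using assms(3) by (simp add: supp_def)
  then show ?thesis
    using sft_guarantee_recovers[OF assms] False by force
qed


section \<open>The error estimate\<close>

text \<open>The row transforms enter through \<open>V_close\<close>, a bound valid for recovered and
  missed entries alike; for \<open>v\<close> the full guarantee is kept, because its support and its
  \<open>\<eta>2\<close> bound shape the output.\<close>

locale two_dim_dft =
  fixes d N M s :: nat
    and f :: "(nat \<Rightarrow> real) \<Rightarrow> complex"
    and I :: "(nat \<Rightarrow> int) set"
    and z :: "nat \<Rightarrow> int"
    and \<tau> \<eta>inf \<eta>2 :: real
    and v :: "nat \<Rightarrow> complex"
    and V :: "nat \<Rightarrow> nat \<Rightarrow> nat \<Rightarrow> complex"
  assumes N_pos: "0 < N" and M_pos: "0 < M"
    and f_wiener: "wiener d f"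
    and I_subset: "I \<subseteq> freq_box d N"
    and recon: "reconstructing d z M I"
    and v_guarantee:
      "sft_guarantee s M \<tau> \<eta>inf \<eta>2 (\<lambda>t. fourier_trunc d I f (lattice_pt d z t)) v"
    and V_close: "\<lbrakk>l < d; j < N; w < M\<rbrakk> \<Longrightarrow>
      cmod (dft_samples M (\<lambda>t. fourier_trunc d I f (row_pt d N z l j t)) (int w) - V l j w) \<le> \<tau>"
    and sparse: "card ({k. fourier_coeff d f k \<noteq> 0} \<inter> significant d I f \<tau>) \<le> s"
begin

abbreviation c :: "(nat \<Rightarrow> int) \<Rightarrow> complex" where
  "c \<equiv> fourier_coeff d f"

abbreviation D :: "int \<Rightarrow> complex" where
  "D \<equiv> dft_samples M (\<lambda>t. fourier_trunc d I f (lattice_pt d z t))"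

definition \<omega> :: "(nat \<Rightarrow> int) \<Rightarrow> nat" where
  "\<omega> k = nat (idot d k z mod int M)"

lemma \<omega>_less [simp]: "\<omega> k < M"
  using M_pos by (simp add: \<omega>_def nat_less_iff)

lemma \<omega>_eq_iff: "w < M \<Longrightarrow> \<omega> k = w \<longleftrightarrow> [idot d k z = int w] (mod int M)"
  using M_pos by (auto simp: \<omega>_def cong_def nat_eq_iff)

lemma \<omega>_cong: "[idot d k z = int (\<omega> k)] (mod int M)"
  using \<omega>_eq_iff[of "\<omega> k" k] by simp

lemma inj_\<omega>: "inj_on \<omega> I"
proof (rule inj_onI)
  fix k k' assume "k \<in> I" "k' \<in> I" "\<omega> k = \<omega> k'"
  then have "idot d k z mod int M = idot d k' z mod int M"
    using \<omega>_cong[of k] \<omega>_cong[of k'] by (simp add: cong_def)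
  then show "k = k'"
    using recon \<open>k \<in> I\<close> \<open>k' \<in> I\<close> by (auto simp: reconstructing_def inj_on_def)
qed

lemma finite_I: "finite I"
  using I_subset finite_freq_box by (rule finite_subset)

lemma \<eta>inf_bounds: "0 \<le> \<eta>inf" "\<eta>inf < \<tau>"
  using v_guarantee by (auto simp: sft_guarantee_def)

lemma finite_supp: "finite (supp M v)"
  by (rule finite_subset[of _ "{..<M}"]) (auto simp: supp_def)

lemma D_eq: "w < M \<Longrightarrow> D (int w) = (\<Sum>k\<in>I. c k * of_bool (\<omega> k = w))"
  by (simp add: dft_samples_lattice[OF M_pos] \<omega>_eq_iff)

lemma D_eq_coeff:
  assumes "k \<in> I"
  shows "D (int (\<omega> k)) = c k"
proof -
  have "D (int (\<omega> k)) = (\<Sum>k'\<in>I. if k' = k then c k else 0)"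
    unfolding D_eq[OF \<omega>_less] using assms inj_\<omega> by (intro sum.cong) (auto simp: inj_on_def)
  then show ?thesis
    using assms finite_I by simp
qed

lemma D_eq_0:
  assumes "w < M" "w \<notin> \<omega> ` I"
  shows "D (int w) = 0"
  unfolding D_eq[OF assms(1)] using assms(2) by (intro sum.neutral) auto

lemma v_close:
  assumes "w \<in> supp M v"
  shows "cmod (D (int w) - v w) \<le> \<eta>inf"
  using assms v_guarantee by (auto simp: sft_guarantee_def)

text \<open>Every lattice frequency above the tolerance comes from a
  \<open>\<tau>\<close>-significant \<open>k\<close>, so there are at most \<open>s\<close> of them
  and \<open>sft_guarantee_recovers\<close> applies.\<close>

lemma significant_in_supp:
  assumes "k \<in> I" "\<tau> < cmod (c k)"
  shows "\<omega> k \<in> supp M v"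
proof -
  let ?a = "\<lambda>t. fourier_trunc d I f (lattice_pt d z t)"
  have "card (above_tol M \<tau> ?a) \<le> card (significant d I f \<tau>)"
  proof (rule surj_card_le)
    show "finite (significant d I f \<tau>)"
      using finite_I by (simp add: significant_def)
    \<comment> \<open>\<open>r k\<close> is the balanced representative of the residue of
      \<open>k\<close>, unique by \<open>BN_cong_imp_eq\<close>; the cardinalities are compared by
      showing that \<open>r\<close> covers \<open>above_tol\<close>.\<close>
    define r where "r k = (SOME h. h \<in> BN M \<and> [h = int (\<omega> k)] (mod int M))" for k
    show "above_tol M \<tau> ?a \<subseteq> r ` significant d I f \<tau>"
    proof
      fix h assume h: "h \<in> above_tol M \<tau> ?a"
      define w where "w = nat (h mod int M)"
      have w: "w < M" "[h = int w] (mod int M)"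
        using M_pos by (auto simp: w_def nat_less_iff cong_def)
      then have "\<tau> < cmod (D (int w))"
        using h dft_samples_mod_cong[OF M_pos, of h "int w" ?a] by (simp add: above_tol_def)
      \<comment> \<open>\<open>\<tau>\<close> is positive, so \<open>D\<close> does not vanish at
        \<open>w\<close> and \<open>w\<close> must be the residue of some frequency in
        \<open>I\<close>.\<close>
      moreover from this obtain k where k: "k \<in> I" "w = \<omega> k"
        using D_eq_0[OF w(1)] \<eta>inf_bounds by fastforce
      ultimately have "k \<in> significant d I f \<tau>"
        by (simp add: D_eq_coeff significant_def)
      moreover have "r k = h"
        unfolding r_def
      proof (rule some_equality)
        show "h \<in> BN M \<and> [h = int (\<omega> k)] (mod int M)"
          using h w k by (simp add: above_tol_def)
        then show "h' = h" if "h' \<in> BN M \<and> [h' = int (\<omega> k)] (mod int M)" for h'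
          using that by (metis BN_cong_imp_eq cong_sym cong_trans)
      qed
      ultimately show "h \<in> r ` significant d I f \<tau>" by blast
    qed
  qed
  also have "significant d I f \<tau> = {k. c k \<noteq> 0} \<inter> significant d I f \<tau>"
    using \<eta>inf_bounds by (auto simp: significant_def)
  finally have "card (above_tol M \<tau> ?a) \<le> s"
    using sparse by simp
  then show ?thesis
    using sft_guarantee_recovers[OF v_guarantee _ \<omega>_less] assms by (simp add: D_eq_coeff)
qed

text \<open>In the exact double transform, a contributing \<open>k'\<close> satisfies
  \<open>k' l = h\<close>, as congruent elements of \<open>BN N\<close> are equal. Admissibility of
  the pair then forces \<open>\<omega> k' = \<omega> k\<close>, so \<open>k' = k\<close> by
  injectivity. The rows are off by at most \<open>\<tau>\<close>, and the transform over
  \<open>j\<close> does not enlarge this.\<close>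

lemma dft_V_close:
  assumes "l < d" "h \<in> BN N" "w' < M" "k \<in> I" "[h * z l + int w' = int (\<omega> k)] (mod int M)"
  shows "cmod ((if k l = h then c k else 0) - dft N (\<lambda>j. V l j w') h) \<le> \<tau>"
proof -
  have *: "[idot d (k'(l := 0)) z = int w'] (mod int M) \<and> [k' l = h] (mod int N)
      \<longleftrightarrow> k' = k \<and> k l = h" if k': "k' \<in> I" for k'
  proof -
    have h: "[k' l = h] (mod int N) \<longleftrightarrow> k' l = h"
      using BN_cong_imp_eq[of "k' l" N h] assms(1,2) k' I_subset by (auto simp: freq_box_def)
    have "[idot d (k'(l := 0)) z = int w'] (mod int M) \<longleftrightarrow> [idot d k' z = int (\<omega> k)] (mod int M)"
      if "k' l = h"
    proof -
      have "[idot d (k'(l := 0)) z = int w'] (mod int M)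
          \<longleftrightarrow> [idot d k' z = h * z l + int w'] (mod int M)"
        using that by (simp add: idot_split[OF assms(1), of k'] cong_add_lcancel)
      then show ?thesis
        using assms(5) cong_trans cong_sym by blast
    qed
    moreover have "[idot d k' z = int (\<omega> k)] (mod int M) \<longleftrightarrow> k' = k"
      using \<omega>_eq_iff[OF \<omega>_less, of k' k] inj_\<omega> k' assms(4) by (auto simp: inj_on_def)
    ultimately show ?thesis using h by auto
  qed
  have "dft N (\<lambda>j. dft_samples M (\<lambda>t. fourier_trunc d I f (row_pt d N z l j t)) (int w')) h
      = (\<Sum>k'\<in>I. if k' = k then (if k l = h then c k else 0) else 0)"
    unfolding dft_dft_samples_row[OF M_pos N_pos assms(1)]
    using * by (intro sum.cong) (auto simp flip: of_bool_conj)
  also have "\<dots> = (if k l = h then c k else 0)"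
    using assms(4) finite_I by simp
  finally have "(if k l = h then c k else 0) - dft N (\<lambda>j. V l j w') h
      = dft N (\<lambda>j. dft_samples M (\<lambda>t. fourier_trunc d I f (row_pt d N z l j t)) (int w') - V l j w') h"
    by (simp add: dft_diff)
  then show ?thesis
    using V_close[OF assms(1) _ assms(3)] N_pos by (simp add: cmod_dft_le)
qed

text \<open>At the true component the difference to be minimized is below \<open>2\<tau>\<close>; at any other component the
  exact two-dimensional transform vanishes, so the difference exceeds \<open>4\<tau> - 2\<tau>\<close>.\<close>

lemma minimizer_eq_component:
  assumes "k \<in> I" "4 * \<tau> < cmod (c k)" "l < d"
    and min: "is_arg_min (\<lambda>(h, w'). cmod (v (\<omega> k) - dft N (\<lambda>j. V l j w') h))
      (\<lambda>(h, w'). h \<in> BN N \<and> w' < M \<and> [h * z l + int w' = int (\<omega> k)] (mod int M)) (h, w')"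
  shows "h = k l"
proof (rule ccontr)
  assume "h \<noteq> k l"
  have hw: "h \<in> BN N" "w' < M" "[h * z l + int w' = int (\<omega> k)] (mod int M)"
    using min by (auto simp: is_arg_min_def)
  have v: "cmod (c k - v (\<omega> k)) \<le> \<eta>inf"
    using v_close[of "\<omega> k"] significant_in_supp[of k] assms(1,2) \<eta>inf_bounds
    by (simp add: D_eq_coeff)
  \<comment> \<open>This is the second component that makes the pair with first component
    \<open>k l\<close> admissible, so the minimizer has to compete with the entry at
    \<open>(k l, w)\<close>.\<close>
  define w where "w = nat (idot d (k(l := 0)) z mod int M)"
  have w: "w < M" "[k l * z l + int w = int (\<omega> k)] (mod int M)"
  proof -
    show "w < M" using M_pos by (simp add: w_def nat_less_iff)
    have "[k l * z l + int w = k l * z l + idot d (k(l := 0)) z] (mod int M)"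
      using M_pos by (intro cong_add) (auto simp: w_def cong_def)
    then show "[k l * z l + int w = int (\<omega> k)] (mod int M)"
      using \<omega>_cong[of k] by (metis idot_split[OF assms(3)] cong_trans)
  qed
  have kl: "k l \<in> BN N"
    using assms(1,3) I_subset by (auto simp: freq_box_def)
  have "cmod (v (\<omega> k) - dft N (\<lambda>j. V l j w) (k l)) \<le> \<eta>inf + \<tau>"
    using dft_V_close[OF assms(3) kl w(1) assms(1) w(2)] v
      norm_triangle_ineq[of "v (\<omega> k) - c k" "c k - dft N (\<lambda>j. V l j w) (k l)"]
    by (simp add: norm_minus_commute)
  moreover have "\<not> cmod (v (\<omega> k) - dft N (\<lambda>j. V l j w) (k l))
      < cmod (v (\<omega> k) - dft N (\<lambda>j. V l j w') h)"
    using min kl w by (auto simp: is_arg_min_def)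
  moreover have "cmod (dft N (\<lambda>j. V l j w') h) \<le> \<tau>"
    using dft_V_close[OF assms(3) hw(1,2) assms(1) hw(3)] \<open>h \<noteq> k l\<close> by simp
  \<comment> \<open>The three terms are at most \<open>\<eta>inf\<close>,
    \<open>\<eta>inf + \<tau>\<close> and \<open>\<tau>\<close>. Their sum is below
    \<open>4 * \<tau>\<close>, which explains the threshold.\<close>
  moreover have "cmod (c k) \<le> cmod (c k - v (\<omega> k))
      + cmod (v (\<omega> k) - dft N (\<lambda>j. V l j w') h) + cmod (dft N (\<lambda>j. V l j w') h)"
    using norm_triangle_ineq[of "c k - v (\<omega> k)" "v (\<omega> k)"]
      norm_triangle_ineq[of "v (\<omega> k) - dft N (\<lambda>j. V l j w') h" "dft N (\<lambda>j. V l j w') h"] by simp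
  ultimately show False
    using v assms(2) \<eta>inf_bounds by linarith
qed

lemma output_estimate:
  assumes "tddft_output d N M z v V b"
  shows "{k. b k \<noteq> 0} \<subseteq> freq_box d N" "card {k. b k \<noteq> 0} \<le> s"
    and "l2norm d (\<lambda>k. b k - c k)
       \<le> \<eta>2 + (4 * \<tau> + \<eta>inf) * sqrt (max (real s - real (card (significant d I f (4 * \<tau>)))) 0)
         + l2norm d (\<lambda>k. restr I c k - restr (significant d I f (4 * \<tau>)) c k)
         + l2norm d (\<lambda>k. c k - restr I c k)"
proof -
  obtain \<kappa> where \<kappa>_freqs: "\<And>w. w \<in> supp M v \<Longrightarrow> \<kappa> w \<in> freqs d"
    and \<kappa>_min: "\<And>w l. \<lbrakk>w \<in> supp M v; l < d\<rbrakk> \<Longrightarrow> \<exists>w'. is_arg_min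
        (\<lambda>(h, w'). cmod (v w - dft N (\<lambda>j. V l j w') h))
        (\<lambda>(h, w'). h \<in> BN N \<and> w' < M \<and> [h * z l + int w' = int w] (mod int M)) (\<kappa> w l, w')"
    and b_eq: "b = (\<lambda>k. \<Sum>w | w \<in> supp M v \<and> \<kappa> w = k \<and> [idot d k z = int w] (mod int M). v w)"
    using assms unfolding tddft_output_def by blast
  \<comment> \<open>The congruence check leaves only \<open>w = \<omega> k\<close> as a possible
    contribution to \<open>b k\<close>. Nothing accumulates, and \<open>B\<close> turns out to be
    the support of \<open>b\<close>.\<close>
  define B where "B = {k. \<omega> k \<in> supp M v \<and> \<kappa> (\<omega> k) = k}"
  have b: "b k = (if k \<in> B then v (\<omega> k) else 0)" for k
  proof -
    have "{w. w \<in> supp M v \<and> \<kappa> w = k \<and> [idot d k z = int w] (mod int M)}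
        = (if k \<in> B then {\<omega> k} else {})"
    proof -
      have "[idot d k z = int w] (mod int M) \<longleftrightarrow> \<omega> k = w" if "w \<in> supp M v" for w
        using that \<omega>_eq_iff[of w k] by (simp add: supp_def)
      then have "{w. w \<in> supp M v \<and> \<kappa> w = k \<and> [idot d k z = int w] (mod int M)}
          = {w. w \<in> supp M v \<and> \<kappa> w = k \<and> \<omega> k = w}"
        by blast
      then show ?thesis by (auto simp: B_def)
    qed
    then show ?thesis by (simp add: b_eq)
  qed
  have b_supp: "{k. b k \<noteq> 0} = B"
    by (auto simp: b B_def supp_def)
  have \<kappa>_box: "\<kappa> w \<in> freq_box d N" if "w \<in> supp M v" for w
    unfolding freq_box_def
  proof (rule PiE_I)
    fix l assume "l \<in> {..<d}"
    then show "\<kappa> w l \<in> BN N"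
      using \<kappa>_min[OF that] by (fastforce simp: is_arg_min_def)
  qed (use \<kappa>_freqs[OF that] in \<open>auto simp: freqs_def\<close>)
  have B_box: "B \<subseteq> freq_box d N"
    using \<kappa>_box by (force simp: B_def)
  then show "{k. b k \<noteq> 0} \<subseteq> freq_box d N"
    by (simp add: b_supp)
  have finite_B: "finite B"
    using B_box finite_freq_box by (rule finite_subset)
  have inj_B: "inj_on \<omega> B"
    by (rule inj_on_inverseI[of _ \<kappa>]) (simp add: B_def)
  have "card B = card (\<omega> ` B)"
    using inj_B by (simp add: card_image)
  also have "\<dots> \<le> card (supp M v)"
    using finite_supp by (intro card_mono) (auto simp: B_def)
  also have "\<dots> \<le> s"
    using v_guarantee by (simp add: sft_guarantee_def)
  finally have card_B: "card B \<le> s" .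
  then show "card {k. b k \<noteq> 0} \<le> s"
    by (simp add: b_supp)

  let ?S = "significant d I f (4 * \<tau>)"
  have S_B: "?S \<subseteq> B"
  proof
    fix k assume "k \<in> ?S"
    then have k: "k \<in> I" "4 * \<tau> < cmod (c k)"
      by (auto simp: significant_def)
    then have supp: "\<omega> k \<in> supp M v"
      using \<eta>inf_bounds by (intro significant_in_supp) auto
    moreover have "\<kappa> (\<omega> k) = k"
    proof (rule PiE_ext)
      show "\<kappa> (\<omega> k) \<in> {..<d} \<rightarrow>\<^sub>E BN N" "k \<in> {..<d} \<rightarrow>\<^sub>E BN N"
        using \<kappa>_box[OF supp] k(1) I_subset by (auto simp: freq_box_def)
      show "\<kappa> (\<omega> k) l = k l" if "l \<in> {..<d}" for l
        using \<kappa>_min[OF supp] minimizer_eq_component[OF k] that by blast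
    qed
    ultimately show "k \<in> B" by (simp add: B_def)
  qed

  \<comment> \<open>\<open>H\<close> consists of the wrong destinations: the value approximates a
    coefficient of some frequency in \<open>I\<close> but was placed outside
    \<open>I\<close>.\<close>
  define H where "H = {k \<in> B - I. \<omega> k \<in> \<omega> ` I}"
  \<comment> \<open>For \<open>k\<close> in \<open>B - I\<close> outside \<open>H\<close> the exact
    value \<open>D\<close> is 0, so the whole entry of \<open>v\<close> is a transform error and is
    charged to \<open>\<eta>2\<close> as well.\<close>
  define X1 where "X1 k = (if k \<in> B - H then v (\<omega> k) - D (int (\<omega> k)) else 0)" for k
  define X2 where "X2 k = (if k \<in> H then v (\<omega> k) else 0)" for k
  define X3 where "X3 k = (if k \<in> I - B then - c k else 0)" for k
  define F where "F = B \<union> I"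
  have F: "finite F" "F \<subseteq> freqs d"
    using finite_B finite_I B_box I_subset freq_box_subset_freqs[of d N] by (auto simp: F_def)
  have zero: "X1 k = 0" "X2 k = 0" "X3 k = 0" if "k \<notin> F" for k
    using that by (auto simp: X1_def X2_def X3_def F_def H_def)
  have decomp: "b k - restr I c k = X1 k + (X2 k + X3 k)" for k
  proof (cases "k \<in> B")
    case True
    show ?thesis
    proof (cases "k \<in> I")
      case True
      then show ?thesis
        using \<open>k \<in> B\<close> by (simp add: b restr_def X1_def X2_def X3_def H_def D_eq_coeff)
    next
      case False
      then show ?thesis
        using \<open>k \<in> B\<close> D_eq_0[OF \<omega>_less, of k] by (auto simp: b restr_def X1_def X2_def X3_def H_def)
    qed
  next
    case False
    then show ?thesis
      by (auto simp: b restr_def X1_def X2_def X3_def H_def)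
  qed

  have X1: "l2norm d X1 \<le> \<eta>2"
  proof -
    have "l2norm d X1 = sqrt (\<Sum>k\<in>F. (cmod (X1 k))\<^sup>2)"
      by (simp add: l2norm_finite[OF F] zero L2_set_def)
    also have "(\<Sum>k\<in>F. (cmod (X1 k))\<^sup>2) = (\<Sum>k\<in>B - H. (cmod (X1 k))\<^sup>2)"
      using F(1) by (intro sum.mono_neutral_right) (auto simp: F_def X1_def)
    also have "\<dots> = (\<Sum>k\<in>B - H. (cmod (D (int (\<omega> k)) - v (\<omega> k)))\<^sup>2)"
      by (simp add: X1_def norm_minus_commute)
    \<comment> \<open>Injectivity of \<open>\<omega>\<close> on \<open>B\<close> ensures that each
      entry of the transform error is counted at most once.\<close>
    also have "\<dots> = (\<Sum>w\<in>\<omega> ` (B - H). (cmod (D (int w) - v w))\<^sup>2)"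
      by (subst sum.reindex) (use inj_B in \<open>auto intro: inj_on_subset\<close>)
    also have "\<dots> \<le> (\<Sum>w<M. (cmod (D (int w) - v w))\<^sup>2)"
      by (intro sum_mono2) auto
    also have "sqrt \<dots> \<le> \<eta>2"
      using v_guarantee by (simp add: sft_guarantee_def L2_set_def)
    finally show ?thesis by simp
  qed
  have X2: "l2norm d X2 \<le> (4 * \<tau> + \<eta>inf) * sqrt (max (real s - real (card ?S)) 0)"
  proof -
    have le: "cmod (X2 k) \<le> 4 * \<tau> + \<eta>inf" if H: "k \<in> H" for k
    proof -
      obtain k' where k': "k' \<in> I" "\<omega> k = \<omega> k'"
        using H by (auto simp: H_def)
      have k: "k \<in> B" "k \<notin> I"
        using H by (auto simp: H_def)
      \<comment> \<open>A \<open>4 * \<tau>\<close>-significant \<open>k'\<close> would lie in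
        \<open>B\<close> with the same residue as \<open>k\<close>, forcing \<open>k = k'\<close>
        although only \<open>k'\<close> is in \<open>I\<close>.\<close>
      have "k' \<notin> ?S"
      proof
        assume "k' \<in> ?S"
        then have "k = k'"
          using S_B k(1) k'(2) inj_B by (auto simp: inj_on_def)
        then show False using k(2) k'(1) by simp
      qed
      then have "cmod (c k') \<le> 4 * \<tau>"
        using k'(1) by (simp add: significant_def)
      moreover have "cmod (c k' - v (\<omega> k)) \<le> \<eta>inf"
        using v_close[of "\<omega> k"] k(1) k' by (simp add: B_def D_eq_coeff)
      ultimately show ?thesis
        using norm_triangle_ineq2[of "v (\<omega> k)" "c k'"] H
        by (simp add: X2_def norm_minus_commute)
    qed
    \<comment> \<open>\<open>H\<close> avoids \<open>I\<close> while \<open>?S\<close> lies in it.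
      Both fit disjointly into \<open>B\<close>, which has at most \<open>s\<close>
      elements.\<close>
    have "card H + card ?S = card (H \<union> ?S)"
      using S_B finite_B
      by (intro card_Un_disjoint[symmetric]) (auto simp: H_def significant_def intro: finite_subset)
    also have "\<dots> \<le> card B"
      using S_B finite_B by (intro card_mono) (auto simp: H_def)
    finally have card_H: "real (card H) \<le> max (real s - real (card ?S)) 0"
      using card_B by simp
    have "l2norm d X2 = sqrt (\<Sum>k\<in>F. (cmod (X2 k))\<^sup>2)"
      by (simp add: l2norm_finite[OF F] zero L2_set_def)
    also have "(\<Sum>k\<in>F. (cmod (X2 k))\<^sup>2) = (\<Sum>k\<in>H. (cmod (X2 k))\<^sup>2)"
      using F(1) by (intro sum.mono_neutral_right) (auto simp: F_def X2_def H_def)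
    also have "sqrt \<dots> = L2_set (\<lambda>k. cmod (X2 k)) H"
      by (simp add: L2_set_def)
    also have "\<dots> \<le> L2_set (\<lambda>k. 4 * \<tau> + \<eta>inf) H"
      using le by (intro L2_set_mono) auto
    also have "\<dots> = sqrt (card H) * (4 * \<tau> + \<eta>inf)"
      using \<eta>inf_bounds by (simp add: L2_set_constant)
    also have "\<dots> \<le> sqrt (max (real s - real (card ?S)) 0) * (4 * \<tau> + \<eta>inf)"
      using card_H \<eta>inf_bounds by (intro mult_right_mono real_sqrt_le_mono) auto
    finally show ?thesis by (simp add: mult.commute)
  qed
  have X3: "l2norm d X3 \<le> l2norm d (\<lambda>k. restr I c k - restr ?S c k)"
  proof -
    have "l2norm d X3 = L2_set (\<lambda>k. cmod (X3 k)) F"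
      by (rule l2norm_finite[OF F]) (rule zero)
    \<comment> \<open>A frequency of \<open>I\<close> missing from \<open>B\<close> is not in
      \<open>?S\<close>, so the right-hand sequence has the value \<open>c k\<close> there.\<close>
    also have "\<dots> \<le> L2_set (\<lambda>k. cmod (restr I c k - restr ?S c k)) F"
      using S_B by (intro L2_set_mono) (auto simp: X3_def restr_def)
    also have "\<dots> = l2norm d (\<lambda>k. restr I c k - restr ?S c k)"
      by (rule l2norm_finite[OF F, symmetric]) (auto simp: F_def restr_def significant_def)
    finally show ?thesis .
  qed

  have sq: "(\<lambda>k. (cmod (x k))\<^sup>2) summable_on freqs d" if "\<And>k. k \<notin> F \<Longrightarrow> x k = 0" for x
    using F(1) that by (rule square_summable_finite)
  have "(\<lambda>k. (cmod (restr I c k - c k))\<^sup>2) summable_on freqs d"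
  proof (rule summable_on_comparison_test)
    show "(\<lambda>k. (cmod (c k))\<^sup>2) summable_on freqs d"
      using f_wiener by (intro square_summable_if_abs_summable) (simp add: wiener_def)
  qed (auto simp: restr_def)
  then have "l2norm d (\<lambda>k. (X1 k + (X2 k + X3 k)) + (restr I c k - c k))
      \<le> l2norm d (\<lambda>k. X1 k + (X2 k + X3 k)) + l2norm d (\<lambda>k. restr I c k - c k)"
    by (rule l2norm_triangle[rotated]) (rule sq, simp add: zero)
  also have "l2norm d (\<lambda>k. X1 k + (X2 k + X3 k)) \<le> l2norm d X1 + l2norm d (\<lambda>k. X2 k + X3 k)"
    by (intro l2norm_triangle sq) (simp_all add: zero)
  also have "l2norm d (\<lambda>k. X2 k + X3 k) \<le> l2norm d X2 + l2norm d X3"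
    by (intro l2norm_triangle sq) (simp_all add: zero)
  also have "l2norm d (\<lambda>k. restr I c k - c k) = l2norm d (\<lambda>k. c k - restr I c k)"
    by (simp add: l2norm_def norm_minus_commute)
  finally show "l2norm d (\<lambda>k. b k - c k)
       \<le> \<eta>2 + (4 * \<tau> + \<eta>inf) * sqrt (max (real s - real (card ?S)) 0)
         + l2norm d (\<lambda>k. restr I c k - restr ?S c k)
         + l2norm d (\<lambda>k. c k - restr I c k)"
    using X1 X2 X3 unfolding decomp[symmetric] by simp
qed

end


section \<open>The output of the program\<close>

lemma supp_list [simp]:
  "set (supp_list M v) = supp M v" "distinct (supp_list M v)" "length (supp_list M v) = card (supp M v)"
proof -
  have "finite (supp M v)"
    by (rule finite_subset[of _ "{..<M}"]) (auto simp: supp_def)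
  then show "set (supp_list M v) = supp M v" "distinct (supp_list M v)"
    "length (supp_list M v) = card (supp M v)"
    by (simp_all add: supp_list_def)
qed

lemma set_BN_list [simp]: "set (BN_list N) = BN N"
  by (auto simp: BN_list_def BN_def)

lemma length_BN_list [simp]: "length (BN_list N) = N"
  by (simp add: BN_list_def) linarith

lemma BN_list_nonempty: "0 < N \<Longrightarrow> BN_list N \<noteq> []"
  by (metis length_BN_list length_0_conv less_numeral_extra(3))

lemma map_of_zip_map: "map_of (zip xs (map F xs)) x = (if x \<in> set xs then Some (F x) else None)"
  by (induction xs) auto

lemma dft_cong: "(\<And>j. j < n \<Longrightarrow> x j = y j) \<Longrightarrow> dft n x w = dft n y w"
  by (simp add: dft_def)

text \<open>Columns absent from the dictionary vanish, and so do their transforms, which matches the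
  default 0. Negative \<open>h\<close> are looked up at \<open>h mod int N\<close>, justified by
  periodicity.\<close>

lemma run_coord_prog:
  assumes "0 < N" "w' < M"
  shows "run g (coord_prog d N M z sft l) w' h
    = dft N (\<lambda>j. run (\<lambda>t. g (row_pt d N z l j t)) sft w') h"
proof -
  define row where "row j = run (\<lambda>t. g (row_pt d N z l j t)) sft" for j
  define cols where "cols = remdups (concat (map (supp_list M) (map row [0..<N])))"
  have eq: "run g (coord_prog d N M z sft l) w' h
      = (if w' \<in> set cols then run g (fft N (map (\<lambda>j. (map row [0..<N] ! j) w') [0..<N])) ! nat (h mod int N)
         else 0)"
    unfolding coord_prog_def by (simp add: Let_def map_of_zip_map cols_def flip: row_def)
  show ?thesis
  proof (cases "w' \<in> set cols")
    case True
    have "run g (coord_prog d N M z sft l) w' h = dft N (\<lambda>j. row j w') (int (nat (h mod int N)))"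
      using True assms(1) unfolding eq
      by (simp add: run_fft nat_less_iff) (intro dft_cong, simp)
    also have "\<dots> = dft N (\<lambda>j. row j w') h"
      using assms(1) by (intro dft_mod_cong) (auto simp: cong_def)
    finally show ?thesis
      by (simp add: row_def)
  next
    case False
    then have "row j w' = 0" if "j < N" for j
      using that assms(2) by (auto simp: cols_def supp_def)
    then show ?thesis
      using False by (simp add: eq dft_def flip: row_def)
  qed
qed

lemma is_arg_min_arg_min_list:
  fixes F :: "'a \<Rightarrow> 'b :: linorder"
  assumes "xs \<noteq> []"
  shows "is_arg_min F (\<lambda>x. x \<in> set xs) (arg_min_list F xs)"
  using arg_min_list_in[OF assms, of F] f_arg_min_list_f[OF assms, of F]
  by (simp add: is_arg_min_linorder)

text \<open>The start value \<open>b0\<close> is arbitrary to make the induction go through.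
  Distinctness matters because the sum over a set counts each \<open>w\<close> once.\<close>

lemma fold_scatter:
  fixes v :: "'a \<Rightarrow> complex"
  assumes "distinct ws"
  shows "fold (\<lambda>w b. if Q w then b(\<kappa> w := b (\<kappa> w) + v w) else b) ws b0 k
    = b0 k + (\<Sum>w | w \<in> set ws \<and> \<kappa> w = k \<and> Q w. v w)"
  using assms
proof (induction ws arbitrary: b0)
  case (Cons a ws)
  let ?b = "if Q a then b0(\<kappa> a := b0 (\<kappa> a) + v a) else b0"
  have "{w. w \<in> set (a # ws) \<and> \<kappa> w = k \<and> Q w}
      = (if \<kappa> a = k \<and> Q a then insert a else id) {w. w \<in> set ws \<and> \<kappa> w = k \<and> Q w}"
    by auto
  then have "(\<Sum>w | w \<in> set (a # ws) \<and> \<kappa> w = k \<and> Q w. v w)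
      = (if \<kappa> a = k \<and> Q a then v a else 0) + (\<Sum>w | w \<in> set ws \<and> \<kappa> w = k \<and> Q w. v w)"
    using Cons.prems by simp
  then show ?case
    using Cons.IH[of ?b] Cons.prems by (simp add: add.assoc)
qed simp

text \<open>Each \<open>h\<close> has exactly one admissible partner \<open>w'\<close>, so the
  search over the list of \<open>h\<close> finds a minimizer over all admissible pairs.\<close>

lemma tddft_prog_output:
  assumes "0 < N" "0 < M"
  shows "tddft_output d N M z (run (\<lambda>t. g (lattice_pt d z t)) sft)
    (\<lambda>l j. run (\<lambda>t. g (row_pt d N z l j t)) sft) (run g (tddft_prog d N M z sft))"
proof -
  define v where "v = run (\<lambda>t. g (lattice_pt d z t)) sft"
  define V where "V l j = run (\<lambda>t. g (row_pt d N z l j t)) sft" for l j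
  define tab where "tab l = run g (coord_prog d N M z sft l)" for l
  define w' where "w' w l h = nat ((int w - h * z l) mod int M)" for w l h
  define F where "F w l h = cmod (v w - tab l (w' w l h) h)" for w l h
  define \<kappa> where "\<kappa> w = (\<lambda>l\<in>{..<d}. arg_min_list (F w l) (BN_list N))" for w
  have w': "w' w l h < M" "[h * z l + int (w' w l h) = int w] (mod int M)" for w l h
  proof -
    show "w' w l h < M"
      using assms(2) by (simp add: w'_def nat_less_iff)
    have "[int (w' w l h) = int w - h * z l] (mod int M)"
      using assms(2) by (simp add: w'_def)
    then have "[h * z l + int (w' w l h) = h * z l + (int w - h * z l)] (mod int M)"
      by (simp only: cong_add_lcancel)
    then show "[h * z l + int (w' w l h) = int w] (mod int M)"
      by simp
  qed
  have w'_unique: "u = w' w l h" if "u < M" "[h * z l + int u = int w] (mod int M)" for u w l h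
  proof -
    have "[h * z l + int u = h * z l + int (w' w l h)] (mod int M)"
      using that(2) w'(2) by (metis cong_sym cong_trans)
    then show ?thesis
      using that(1) w'(1) by (simp only: cong_add_lcancel) (simp add: cong_def)
  qed
  have tab: "tab l (w' w l h) h = dft N (\<lambda>j. V l j (w' w l h)) h" for w l h
    using run_coord_prog[OF assms(1) w'(1)] by (simp add: tab_def V_def)
  have \<kappa>: "(\<lambda>i\<in>{..<d}. map (\<lambda>l. arg_min_list (F w l) (BN_list N)) [0..<d] ! i) = \<kappa> w" for w
    unfolding \<kappa>_def by (rule ext) simp
  have "run g (tddft_prog d N M z sft)
      = fold (\<lambda>w b. if [idot d (\<kappa> w) z = int w] (mod int M) then b(\<kappa> w := b (\<kappa> w) + v w) else b)
          (supp_list M v) (\<lambda>_. 0)"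
  proof -
    have "map (\<lambda>l. arg_min_list
            (\<lambda>h. cmod (v w - (map tab [0..<d] ! l) (nat ((int w - h * z l) mod int M)) h)) (BN_list N)) [0..<d]
        = map (\<lambda>l. arg_min_list (F w l) (BN_list N)) [0..<d]" for w
      by (simp add: F_def[abs_def] w'_def)
    then show ?thesis
      unfolding tddft_prog_def Let_def run_bind run_fold_m run_map_m run_along run.simps
        v_def[symmetric] tab_def[symmetric]
      by (simp only: \<kappa>)
  qed
  then have run_eq: "run g (tddft_prog d N M z sft)
      = (\<lambda>k. \<Sum>w | w \<in> supp M v \<and> \<kappa> w = k \<and> [idot d (\<kappa> w) z = int w] (mod int M). v w)"
    by (simp add: fun_eq_iff fold_scatter)
  have min: "is_arg_min (\<lambda>(h, w'). cmod (v w - dft N (\<lambda>j. V l j w') h))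
      (\<lambda>(h, w'). h \<in> BN N \<and> w' < M \<and> [h * z l + int w' = int w] (mod int M))
      (\<kappa> w l, w' w l (\<kappa> w l))" if "l < d" for w l
  proof -
    have "is_arg_min (F w l) (\<lambda>h. h \<in> BN N) (\<kappa> w l)"
      using is_arg_min_arg_min_list[OF BN_list_nonempty[OF assms(1)], of "F w l"] that
      by (simp add: \<kappa>_def)
    then show ?thesis
      using w' w'_unique[of _ _ l w] by (auto simp: is_arg_min_def F_def tab)
  qed
  have "tddft_output d N M z v V (run g (tddft_prog d N M z sft))"
    unfolding tddft_output_def
  proof (intro exI[of _ \<kappa>] conjI ballI allI impI)
    show "\<kappa> w \<in> freqs d" for w
      by (auto simp: \<kappa>_def freqs_def)
    show "\<exists>w'. is_arg_min (\<lambda>(h, w'). cmod (v w - dft N (\<lambda>j. V l j w') h))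
        (\<lambda>(h, w'). h \<in> BN N \<and> w' < M \<and> [h * z l + int w' = int w] (mod int M)) (\<kappa> w l, w')"
      if "l < d" for w l
      using min[OF that] by blast
    show "run g (tddft_prog d N M z sft)
        = (\<lambda>k. \<Sum>w | w \<in> supp M v \<and> \<kappa> w = k \<and> [idot d k z = int w] (mod int M). v w)"
      \<comment> \<open>The program tests the congruence for \<open>\<kappa> w\<close>, the
        specification for \<open>k\<close>; the sum only ranges over \<open>w\<close> where the two
        coincide.\<close>
      unfolding run_eq by (intro ext sum.cong) auto
  qed
  then show ?thesis
    by (simp add: v_def V_def[abs_def])
qed


section \<open>The cost of the program\<close>

lemma num_evals_fft [simp]: "num_evals g (fft N xs) = 0"
  by (simp add: fft_def Let_def)

lemma num_evals_coord_prog: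
  "num_evals g (coord_prog d N M z sft l) = (\<Sum>j<N. num_evals (\<lambda>t. g (row_pt d N z l j t)) sft)"
  by (simp add: coord_prog_def Let_def sum_list_distinct_conv_sum_set atLeast0LessThan)

lemma num_evals_tddft_prog:
  "num_evals g (tddft_prog d N M z sft)
    = num_evals (\<lambda>t. g (lattice_pt d z t)) sft
      + (\<Sum>l<d. \<Sum>j<N. num_evals (\<lambda>t. g (row_pt d N z l j t)) sft)"
proof -
  have "num_evals g (tddft_prog d N M z sft)
      = num_evals (\<lambda>t. g (lattice_pt d z t)) sft
        + (\<Sum>l\<leftarrow>[0..<d]. num_evals g (coord_prog d N M z sft l))"
    unfolding tddft_prog_def Let_def by (simp add: num_evals_fold_m_eq_0 o_def)
  then show ?thesis
    by (simp add: num_evals_coord_prog sum_list_distinct_conv_sum_set atLeast0LessThan)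
qed

lemma ln_ge_two_thirds:
  assumes "2 \<le> N"
  shows "2 / 3 \<le> ln (real N)"
proof -
  have "ln 2 \<le> ln (real N)"
    using assms by simp
  then show ?thesis
    using ln2_ge_two_thirds by linarith
qed

text \<open>By minimality of \<open>k\<close> the padded length is at most \<open>4 * N\<close>, so
  \<open>k\<close> is logarithmic in \<open>N\<close>. Linear terms are absorbed using the positive
  lower bound on \<open>ln (real N)\<close> for \<open>2 \<le> N\<close>.\<close>

lemma num_ops_fft_le:
  assumes "2 \<le> N"
  shows "real (num_ops g (fft N xs)) \<le> 3000 * (real N * ln (real N))"
proof -
  define k where "k = (LEAST k. 2 * N \<le> 2 ^ k)"
  define L :: nat where "L = 2 ^ k"
  have ln2: "2 / 3 \<le> ln (2::real)"
    by (rule ln2_ge_two_thirds)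
  have lnN: "ln 2 \<le> ln (real N)"
    using assms by simp
  have "0 < k"
  proof (rule ccontr)
    assume "\<not> 0 < k"
    then have "2 * N \<le> 2 ^ 0"
      using LeastI[of "\<lambda>k. 2 * N \<le> 2 ^ k" "2 * N"] less_imp_le[OF less_exp]
      by (simp add: k_def)
    then show False using assms by simp
  qed
  then have "\<not> 2 * N \<le> 2 ^ (k - 1)"
    unfolding k_def by (intro not_less_Least) simp
  then have L: "L \<le> 4 * N"
    using \<open>0 < k\<close> by (cases k) (auto simp: L_def)
  have "real k * ln 2 = ln (real L)"
    by (simp add: L_def ln_realpow)
  also have "\<dots> \<le> ln (4 * real N)"
  proof -
    have "0 < real L" "real L \<le> 4 * real N"
      using L by (simp add: L_def, linarith)
    then show ?thesis
      by (subst ln_le_cancel_iff) auto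
  qed
  also have "\<dots> = 2 * ln 2 + ln (real N)"
    using assms ln_realpow[of 2 2] by (simp add: ln_mult)
  also have "\<dots> \<le> 3 * ln (real N)"
    using lnN by simp
  finally have "real k * ln 2 \<le> 3 * ln (real N)" .
  moreover have "real k * (2 / 3) \<le> real k * ln 2"
    using ln2 by (intro mult_left_mono) auto
  \<comment> \<open>The factor \<open>9 / 2\<close> is 3 divided by the lower bound
    \<open>2 / 3\<close> of \<open>ln 2\<close>.\<close>
  ultimately have k: "real k \<le> 9 / 2 * ln (real N)"
    by simp
  have "num_ops g (fft N xs) = 16 * k + 48 * L + 16 * N + 96 * (k * L)"
    unfolding fft_def Let_def k_def[symmetric]
    by (simp add: num_ops_fft2 flip: L_def)
  then have "real (num_ops g (fft N xs)) = 16 * real k + 48 * real L + 16 * real N + 96 * (real k * real L)"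
    by simp
  \<comment> \<open>Here \<open>6 = 4 * (3 / 2)\<close> comes from the length bound and
    \<open>18 = (9 / 2) * 4\<close> from the product with \<open>k\<close>; the factors add up to
    2112.\<close>
  also have "\<dots> \<le> 16 * (9 / 2 * (real N * ln (real N))) + 48 * (6 * (real N * ln (real N)))
      + 16 * (3 / 2 * (real N * ln (real N))) + 96 * (18 * (real N * ln (real N)))"
  proof -
    have N: "real N \<le> 3 / 2 * (real N * ln (real N))"
      using mult_left_mono[of "2/3" "ln (real N)" "real N"] ln2 lnN by simp
    have "ln (real N) \<le> real N * ln (real N)"
      using mult_right_mono[of 1 "real N" "ln (real N)"] assms by simp
    then have "real k \<le> 9 / 2 * (real N * ln (real N))"
      using k by simp
    moreover have "real L \<le> 6 * (real N * ln (real N))"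
      using N L by linarith
    moreover have "real k * real L \<le> (9 / 2 * ln (real N)) * (4 * real N)"
      using k L assms by (intro mult_mono) auto
    ultimately show ?thesis
      using N by (intro add_mono mult_left_mono) (auto simp: mult_ac)
  qed
  also have "\<dots> \<le> 3000 * (real N * ln (real N))"
    using assms by simp
  finally show ?thesis .
qed

text \<open>Each of the \<open>N\<close> rows has at most \<open>s\<close> nonzero entries, so at
  most \<open>s * N\<close> columns are transformed, each by one fast Fourier transform.\<close>

lemma num_ops_coord_prog_le:
  fixes T :: real
  assumes "2 \<le> N" "1 \<le> s"
    and T: "\<And>g. real (num_ops g sft) \<le> T"
    and sparse: "\<And>j. j < N \<Longrightarrow> card (supp M (run (\<lambda>t. g (row_pt d N z l j t)) sft)) \<le> s"
  shows "real (num_ops g (coord_prog d N M z sft l))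
    \<le> N * T + 4000 * (real s * real N * (real N * ln (real N)))"
proof -
  define row where "row j = run (\<lambda>t. g (row_pt d N z l j t)) sft" for j
  define entries where "entries = concat (map (supp_list M) (map row [0..<N]))"
  define cols where "cols = remdups entries"
  define E where "E = real N * ln (real N)"
  have N: "real N \<le> 3 / 2 * E"
  proof -
    have "2 / 3 \<le> ln (real N)"
      using assms(1) by (rule ln_ge_two_thirds)
    then show ?thesis
      using mult_left_mono[of "2/3" "ln (real N)" "real N"] by (simp add: E_def)
  qed
  have "length entries = (\<Sum>j<N. card (supp M (row j)))"
    by (simp add: entries_def length_concat o_def sum_list_distinct_conv_sum_set atLeast0LessThan)
  also have "\<dots> \<le> (\<Sum>j<N. s)"
    using sparse by (intro sum_mono) (simp add: row_def)
  finally have entries: "real (length entries) \<le> real s * real N"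
    by (simp add: mult.commute flip: of_nat_mult)
  have "length cols \<le> length entries"
    unfolding cols_def by (rule length_remdups_leq)
  with entries have cols: "real (length cols) \<le> real s * real N"
    by linarith
  define col where "col w' = 16 * N + num_ops g (fft N (map (\<lambda>j. (map row [0..<N] ! j) w') [0..<N]))" for w'
  have col: "real (col w') \<le> 24 * E + 3000 * E" for w'
    using N num_ops_fft_le[OF assms(1), of g "map (\<lambda>j. (map row [0..<N] ! j) w') [0..<N]"]
    unfolding col_def E_def of_nat_add of_nat_mult by simp
  have "num_ops g (coord_prog d N M z sft l)
      = (\<Sum>j\<leftarrow>[0..<N]. 16 + num_ops (\<lambda>t. g (row_pt d N z l j t)) sft)
        + 16 * (N + length entries) + (\<Sum>w'\<leftarrow>cols. 16 + col w')"
    unfolding coord_prog_def Let_def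
    by (simp add: col_def entries_def cols_def flip: row_def)
  also have "real \<dots> \<le> real N * (16 + T) + 16 * (real N + real s * real N)
      + real s * real N * (16 + (24 * E + 3000 * E))"
  proof -
    have "real (\<Sum>j\<leftarrow>[0..<N]. 16 + num_ops (\<lambda>t. g (row_pt d N z l j t)) sft)
        = (\<Sum>j<N. 16 + real (num_ops (\<lambda>t. g (row_pt d N z l j t)) sft))"
      by (simp add: sum_list_distinct_conv_sum_set atLeast0LessThan)
    also have "\<dots> \<le> (\<Sum>j<N. 16 + T)"
      using T by (intro sum_mono) simp
    finally have rows: "real (\<Sum>j\<leftarrow>[0..<N]. 16 + num_ops (\<lambda>t. g (row_pt d N z l j t)) sft)
        \<le> real N * (16 + T)"
      by simp
    have "real (\<Sum>w'\<leftarrow>cols. 16 + col w') = (\<Sum>w'\<in>set cols. 16 + real (col w'))"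
      by (simp add: sum_list_distinct_conv_sum_set cols_def)
    also have "\<dots> \<le> (\<Sum>w'\<in>set cols. 16 + (24 * E + 3000 * E))"
      using col by (intro sum_mono) simp
    also have "\<dots> = real (length cols) * (16 + (24 * E + 3000 * E))"
      by (simp add: cols_def distinct_card[symmetric])
    also have "\<dots> \<le> real s * real N * (16 + (24 * E + 3000 * E))"
      using cols N by (intro mult_right_mono) auto
    finally show ?thesis
      using rows entries by simp
  qed
  also have "\<dots> \<le> N * T + 4000 * (real s * real N * E)"
  proof -
    have E: "1 \<le> E"
      using N assms(1) by simp
    have "real N * 1 \<le> real N * real s"
      using assms(2) by (intro mult_left_mono) auto
    then have *: "real N \<le> real s * real N"
      by (simp add: mult.commute)
    have "real s * real N * 1 \<le> real s * real N * E"
      using E by (intro mult_left_mono) auto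
    with * show ?thesis
      by (simp add: algebra_simps)
  qed
  finally show ?thesis
    by (simp add: E_def)
qed

text \<open>The factor 2 pays for the run along the lattice line, whose bound \<open>T\<close> is at
  most \<open>d * N * T\<close>. The final searches cost on the order of \<open>s * d * N\<close>
  and are dominated by the column transforms.\<close>

lemma num_ops_tddft_prog_le:
  fixes T :: real
  assumes "0 < d" "2 \<le> N" "1 \<le> s"
    and T: "\<And>g. real (num_ops g sft) \<le> T"
    and sparse: "card (supp M (run (\<lambda>t. g (lattice_pt d z t)) sft)) \<le> s"
      "\<And>l j. l < d \<Longrightarrow> j < N \<Longrightarrow> card (supp M (run (\<lambda>t. g (row_pt d N z l j t)) sft)) \<le> s"
  shows "real (num_ops g (tddft_prog d N M z sft))
    \<le> 2 * (real d * real N * T) + 5000 * (real d * real N * (real s * real N * ln (real N)))"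
proof -
  define v where "v = run (\<lambda>t. g (lattice_pt d z t)) sft"
  define E where "E = real N * ln (real N)"
  define S where "S = real s * real N * E"
  have E: "1 \<le> E"
  proof -
    have "2 / 3 \<le> ln (real N)"
      using assms(2) by (rule ln_ge_two_thirds)
    then show ?thesis
      using mult_mono[of 2 "real N" "2/3" "ln (real N)"] assms(2) by (simp add: E_def)
  qed
  have "0 \<le> T"
    using T by (rule order_trans[rotated]) simp
  define tabs where "tabs = map (\<lambda>l. run g (coord_prog d N M z sft l)) [0..<d]"
  \<comment> \<open>Naming the loop body allows \<open>num_ops_fold_m_le\<close> to be applied with
    a bound independent of the accumulated \<open>b\<close>.\<close>
  define body :: "nat \<Rightarrow> ((nat \<Rightarrow> int) \<Rightarrow> complex) \<Rightarrow> (nat \<Rightarrow> real, _) prog"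
    where "body w b = do {
         ks \<leftarrow> map_m (\<lambda>l. do {
             work N;
             Return (arg_min_list
               (\<lambda>h. cmod (v w - (tabs ! l) (nat ((int w - h * z l) mod int M)) h)) (BN_list N))
           }) [0..<d];
         let k = (\<lambda>i\<in>{..<d}. ks ! i);
         work d;
         Return (if [idot d k z = int w] (mod int M) then b(k := b k + v w) else b)
       }" for w b
  have body: "num_ops g (body w b) \<le> d * (16 + 16 * N) + 16 * d" for w b
    by (simp add: body_def Let_def sum_list_triv)
  have "num_ops g (tddft_prog d N M z sft)
      = num_ops (\<lambda>t. g (lattice_pt d z t)) sft + (\<Sum>l\<leftarrow>[0..<d]. 16 + num_ops g (coord_prog d N M z sft l))
        + num_ops g (fold_m body (supp_list M v) (\<lambda>_. 0))"
    unfolding tddft_prog_def num_ops_bind num_ops_map_m num_ops_along run_bind run_map_m run_along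
      tabs_def[symmetric] v_def[symmetric] body_def[abs_def] by (simp only: add.assoc)
  also have "real \<dots> \<le> T + real d * (16 + (real N * T + 4000 * S))
      + real s * (16 + (real d * (16 + 16 * real N) + 16 * real d))"
  proof -
    have "real (\<Sum>l\<leftarrow>[0..<d]. 16 + num_ops g (coord_prog d N M z sft l))
        = (\<Sum>l<d. 16 + real (num_ops g (coord_prog d N M z sft l)))"
      by (simp add: sum_list_distinct_conv_sum_set atLeast0LessThan)
    also have "\<dots> \<le> (\<Sum>l<d. 16 + (real N * T + 4000 * S))"
      unfolding S_def E_def using assms
      by (intro sum_mono add_left_mono num_ops_coord_prog_le) auto
    finally have 1: "real (\<Sum>l\<leftarrow>[0..<d]. 16 + num_ops g (coord_prog d N M z sft l))
        \<le> real d * (16 + (real N * T + 4000 * S))"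
      by simp
    have "num_ops g (fold_m body (supp_list M v) (\<lambda>_. 0))
        \<le> card (supp M v) * (16 + (d * (16 + 16 * N) + 16 * d))"
      using num_ops_fold_m_le[of g body, OF body, of "supp_list M v"] by simp
    also have "\<dots> \<le> s * (16 + (d * (16 + 16 * N) + 16 * d))"
      using sparse(1) by (intro mult_right_mono) (auto simp: v_def)
    finally have "real (num_ops g (fold_m body (supp_list M v) (\<lambda>_. 0)))
        \<le> real (s * (16 + (d * (16 + 16 * N) + 16 * d)))"
      by (rule of_nat_mono)
    then have 2: "real (num_ops g (fold_m body (supp_list M v) (\<lambda>_. 0)))
        \<le> real s * (16 + (real d * (16 + 16 * real N) + 16 * real d))"
      by simp
    show ?thesis
      using T[of "\<lambda>t. g (lattice_pt d z t)"] 1 2 by simp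
  qed
  also have "\<dots> \<le> 2 * (real d * real N * T) + 5000 * (real d * S)"
  proof -
    have "1 * 1 \<le> real d * real N"
      using assms(1,2) by (intro mult_mono) auto
    then have 1: "T \<le> real d * real N * T"
      using \<open>0 \<le> T\<close> mult_right_mono[of 1 "real d * real N" T] by simp
    have sN: "real s * real N \<le> S"
      using E mult_left_mono[of 1 E "real s * real N"] by (simp add: S_def)
    have "real s * 1 \<le> real s * real N"
      using assms(2) by (intro mult_left_mono) auto
    then have "real s \<le> S"
      using sN by simp
    have "1 \<le> S"
      using \<open>real s \<le> S\<close> assms(3) by simp
    have d: "S \<le> real d * S"
      using assms(1) \<open>1 \<le> S\<close> mult_right_mono[of 1 "real d" S] by simp
    have 2: "real d * 1 \<le> real d * S" "real d * real s \<le> real d * S"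
        "real d * (real s * real N) \<le> real d * S"
      using mult_left_mono[OF \<open>1 \<le> S\<close>] mult_left_mono[OF \<open>real s \<le> S\<close>] mult_left_mono[OF sN]
      by (auto simp del: mult_1_right)
    have "T + real d * (16 + (real N * T + 4000 * S))
      + real s * (16 + (real d * (16 + 16 * real N) + 16 * real d))
      = T + real d * real N * T + 16 * (real d * 1) + 4000 * (real d * S) + 16 * real s
        + 32 * (real d * real s) + 16 * (real d * (real s * real N))"
      by (simp add: algebra_simps)
    also have "\<dots> \<le> 2 * (real d * real N * T) + 5000 * (real d * S)"
      using 1 2 d \<open>real s \<le> S\<close> \<open>1 \<le> S\<close> by linarith
    finally show ?thesis .
  qed
  finally show ?thesis
    by (simp add: S_def E_def mult_ac)
qed


text \<open>The constants are quantified before all other parameters and so are uniform in them. A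
  row frequency carries a sum of coefficients, which may exceed \<open>\<tau>\<close> though none of
  them does; hence \<open>above_tol\<close> is bounded for the rows separately. For
  \<open>N = 1\<close> or \<open>s = 0\<close> the term with \<open>ln\<close> vanishes and could
  not absorb the loop overhead, so the operation bound is stated for \<open>2 \<le> N\<close> and
  \<open>1 \<le> s\<close>.\<close>

theorem lemma7:
  fixes A :: "nat \<Rightarrow> nat \<Rightarrow> (real, nat \<Rightarrow> complex) prog"
    and P R :: "nat \<Rightarrow> nat \<Rightarrow> real"
  assumes sft_evals: "\<exists>C>0. \<forall>s M g. 0 < M \<longrightarrow> real (num_evals g (A s M)) \<le> C * P s M"
    and sft_ops: "\<exists>C>0. \<forall>s M g. 0 < M \<longrightarrow> real (num_ops g (A s M)) \<le> C * R s M"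
  shows "\<exists>C1>0. \<exists>C2>0.
    \<forall>(d::nat) (N::nat) (s::nat) (M::nat)
      (f :: (nat \<Rightarrow> real) \<Rightarrow> complex) (\<nu> :: (nat \<Rightarrow> real) \<Rightarrow> complex)
      (I :: (nat \<Rightarrow> int) set) (z :: nat \<Rightarrow> int) (\<tau>::real) (\<eta>inf::real) (\<eta>2::real).
      let g = (\<lambda>x. f x + \<nu> x);
          f\<^sub>I = fourier_trunc d I f;
          c = fourier_coeff d f;
          S = significant d I f;
          v = run (\<lambda>t. g (lattice_pt d z t)) (A s M);
          V = (\<lambda>l j. run (\<lambda>t. g (row_pt d N z l j t)) (A s M));
          p = tddft_prog d N M z (A s M)
      in
        0 < d \<longrightarrow> 0 < N \<longrightarrow> 0 < M \<longrightarrow>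
        wiener d f \<longrightarrow> continuous_torus d f \<longrightarrow>
        I \<subseteq> freq_box d N \<longrightarrow>
        reconstructing d z M I \<longrightarrow>
        (\<forall>l<d. reconstructing d z M ((\<lambda>k. k(l := 0)) ` I)) \<longrightarrow>
        sft_guarantee s M \<tau> \<eta>inf \<eta>2 (\<lambda>t. f\<^sub>I (lattice_pt d z t)) v \<longrightarrow>
        (\<forall>l<d. \<forall>j<N.
           (\<exists>\<eta>2'. sft_guarantee s M \<tau> \<eta>inf \<eta>2' (\<lambda>t. f\<^sub>I (row_pt d N z l j t)) (V l j)) \<and>
           card (above_tol M \<tau> (\<lambda>t. f\<^sub>I (row_pt d N z l j t))) \<le> s) \<longrightarrow>
        card ({k. c k \<noteq> 0} \<inter> S \<tau>) \<le> s \<longrightarrow>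
        (\<forall>b. tddft_output d N M z v V b \<longrightarrow>
           {k. b k \<noteq> 0} \<subseteq> freq_box d N \<and> card {k. b k \<noteq> 0} \<le> s \<and>
           l2norm d (\<lambda>k. b k - c k)
             \<le> \<eta>2 + (4 * \<tau> + \<eta>inf) * sqrt (max (real s - real (card (S (4 * \<tau>)))) 0)
               + l2norm d (\<lambda>k. restr I c k - restr (S (4 * \<tau>)) c k)
               + l2norm d (\<lambda>k. c k - restr I c k)) \<and>
        tddft_output d N M z v V (run g p) \<and>
        real (num_evals g p) \<le> C1 * (real d * real N * P s M) \<and>
        (2 \<le> N \<and> 1 \<le> s \<longrightarrow>
           real (num_ops g p)
             \<le> C2 * (real d * real N * (R s M + real s * real N * ln (real N))))"
proof -
  obtain Ce where Ce: "0 < Ce" "\<And>s M g. 0 < M \<Longrightarrow> real (num_evals g (A s M)) \<le> Ce * P s M"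
    using sft_evals by blast
  obtain Co where Co: "0 < Co" "\<And>s M g. 0 < M \<Longrightarrow> real (num_ops g (A s M)) \<le> Co * R s M"
    using sft_ops by blast
  have evals: "real (num_evals g (tddft_prog d N M z (A s M))) \<le> 2 * Ce * (real d * real N * P s M)"
    if "0 < d" "0 < N" "0 < M" for d N s M z g
  proof -
    define T where "T = Ce * P s M"
    have T: "real (num_evals g (A s M)) \<le> T" for g
      using Ce(2)[OF that(3)] by (simp add: T_def)
    have "0 \<le> T"
      using T by (rule order_trans[rotated]) simp
    have "real (num_evals g (tddft_prog d N M z (A s M)))
        = real (num_evals (\<lambda>t. g (lattice_pt d z t)) (A s M))
          + (\<Sum>l<d. \<Sum>j<N. real (num_evals (\<lambda>t. g (row_pt d N z l j t)) (A s M)))"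
      by (simp add: num_evals_tddft_prog)
    also have "\<dots> \<le> T + (\<Sum>l<d. \<Sum>j<N. T)"
      by (intro add_mono sum_mono T)
    also have "\<dots> = T + real d * real N * T"
      by simp
    also have "\<dots> \<le> 2 * (real d * real N * T)"
    proof -
      have "1 * 1 \<le> real d * real N"
        using that by (intro mult_mono) auto
      then show ?thesis
        using \<open>0 \<le> T\<close> mult_right_mono[of 1 "real d * real N" T] by linarith
    qed
    finally show ?thesis
      by (simp add: T_def mult_ac)
  qed
  have ops: "real (num_ops g (tddft_prog d N M z (A s M)))
      \<le> (2 * Co + 5000) * (real d * real N * (R s M + real s * real N * ln (real N)))"
    if "0 < d" "2 \<le> N" "1 \<le> s" "0 < M"
      and "card (supp M (run (\<lambda>t. g (lattice_pt d z t)) (A s M))) \<le> s"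
        "\<And>l j. l < d \<Longrightarrow> j < N \<Longrightarrow> card (supp M (run (\<lambda>t. g (row_pt d N z l j t)) (A s M))) \<le> s"
    for d N s M z g
  proof -
    have "real (num_ops g (tddft_prog d N M z (A s M)))
        \<le> 2 * (real d * real N * (Co * R s M)) + 5000 * (real d * real N * (real s * real N * ln (real N)))"
      using that Co(2) by (intro num_ops_tddft_prog_le) auto
    moreover have "0 \<le> R s M"
    proof -
      \<comment> \<open>The cost bound holds for every sampled function, so an arbitrary one shows
        that \<open>R s M\<close> bounds a natural number up to a positive factor.\<close>
      have "0 \<le> Co * R s M"
        using Co(2)[OF that(4), of undefined s] by linarith
      then show ?thesis
        using Co(1) by (simp add: zero_le_mult_iff)
    qed
    then have "0 \<le> 5000 * (real d * real N * R s M)"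
      by simp
    moreover have "0 \<le> 2 * Co * (real d * real N * (real s * real N * ln (real N)))"
      using Co(1) that(2) by simp
    ultimately show ?thesis
      by (simp add: algebra_simps)
  qed
  show ?thesis
    unfolding Let_def
  proof (intro exI conjI allI impI)
    show "0 < 2 * Ce" "0 < 2 * Co + 5000"
      using Ce(1) Co(1) by auto
  next
    fix d N s M :: nat and f \<nu> :: "(nat \<Rightarrow> real) \<Rightarrow> complex" and I :: "(nat \<Rightarrow> int) set"
      and z :: "nat \<Rightarrow> int" and \<tau> \<eta>inf \<eta>2 :: real
    let ?g = "\<lambda>x. f x + \<nu> x"
    let ?v = "run (\<lambda>t. ?g (lattice_pt d z t)) (A s M)"
    let ?V = "\<lambda>l j. run (\<lambda>t. ?g (row_pt d N z l j t)) (A s M)"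
    assume pos: "0 < d" "0 < N" "0 < M"
      and f: "wiener d f"
      and I: "I \<subseteq> freq_box d N" "reconstructing d z M I"
      and v: "sft_guarantee s M \<tau> \<eta>inf \<eta>2 (\<lambda>t. fourier_trunc d I f (lattice_pt d z t)) ?v"
      and V: "\<forall>l<d. \<forall>j<N.
           (\<exists>\<eta>2'. sft_guarantee s M \<tau> \<eta>inf \<eta>2' (\<lambda>t. fourier_trunc d I f (row_pt d N z l j t)) (?V l j)) \<and>
           card (above_tol M \<tau> (\<lambda>t. fourier_trunc d I f (row_pt d N z l j t))) \<le> s"
      and sparse: "card ({k. fourier_coeff d f k \<noteq> 0} \<inter> significant d I f \<tau>) \<le> s"
    interpret two_dim_dft d N M s f I z \<tau> \<eta>inf \<eta>2 ?v ?V
    proof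
      fix l j w assume "l < d" "j < N" "w < M"
      then show "cmod (dft_samples M (\<lambda>t. fourier_trunc d I f (row_pt d N z l j t)) (int w) - ?V l j w) \<le> \<tau>"
        using V sft_guarantee_uniform by blast
    qed (use pos f I v sparse in auto)
    show "{k. b k \<noteq> 0} \<subseteq> freq_box d N" "card {k. b k \<noteq> 0} \<le> s"
      "l2norm d (\<lambda>k. b k - fourier_coeff d f k)
       \<le> \<eta>2 + (4 * \<tau> + \<eta>inf) * sqrt (max (real s - real (card (significant d I f (4 * \<tau>)))) 0)
         + l2norm d (\<lambda>k. restr I (fourier_coeff d f) k
             - restr (significant d I f (4 * \<tau>)) (fourier_coeff d f) k)
         + l2norm d (\<lambda>k. fourier_coeff d f k - restr I (fourier_coeff d f) k)"
      if "tddft_output d N M z ?v ?V b" for b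
      using output_estimate[OF that] by auto
    show "tddft_output d N M z ?v ?V (run ?g (tddft_prog d N M z (A s M)))"
      using pos by (intro tddft_prog_output)
    show "real (num_evals ?g (tddft_prog d N M z (A s M))) \<le> 2 * Ce * (real d * real N * P s M)"
      using pos by (rule evals)
    show "real (num_ops ?g (tddft_prog d N M z (A s M)))
        \<le> (2 * Co + 5000) * (real d * real N * (R s M + real s * real N * ln (real N)))"
      if "2 \<le> N \<and> 1 \<le> s"
    proof (rule ops)
      show "card (supp M ?v) \<le> s"
        using v by (simp add: sft_guarantee_def)
      show "card (supp M (?V l j)) \<le> s" if "l < d" "j < N" for l j
        using V that by (auto simp: sft_guarantee_def)
    qed (use pos that in auto)
  qed
qed

end
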